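(* Let $\sigma_1\in\mathbb{R}$ and let $f:\mathbb{R}^d\to\mathbb{R}$ be $\max\{\sigma_1,0\}$-almost convex and $L_1$-smooth. Let $z_1\in\mathbb{R}^d$, let $\Delta_f>0$ satisfy $f(z_1)-\inf_xf(x)\le\Delta_f<\infty$, and let $\epsilon>0$. Let $\gamma\ge\sigma_1$ and let $0<\gamma\le L_1$. Then the procedure $\mathrm{ACAGD}(f,z_1,\epsilon,\gamma,L_1)$ (defined in the context) returns a vector $z$ such that $\|\nabla f(z)\|\le\epsilon$ and $$f(z_1)-f(z)\ge\min\left\{\gamma\|z-z_1\|^2,\ \frac{\epsilon}{\sqrt{10}}\|z-z_1\|\right\}$$ in time $$O\left(\mathsf{T}_{\rm grad}\left(\sqrt{\frac{L_1}{\gamma}}+\frac{\sqrt{\gamma L_1}}{\epsilon^2}\,(f(z_1)-f(z))\right)\log\left(2+\frac{L_1^3\Delta_f}{\gamma^2\epsilon^2}\right)\right).$$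
   Context: Notation. $\|\cdot\|$ is the Euclidean norm; $\log$ is the natural logarithm. $f$ is $L_1$-smooth if it is differentiable and $\|\nabla f(x)-\nabla f(y)\|\le L_1\|x-y\|$ for all $x,y$. For $c\ge0$, $f$ is $c$-almost convex if $f(y)\ge f(x)+\nabla f(x)^T(y-x)-\frac c2\|y-x\|^2$ for all $x,y$. $M_1=O(M_2)$ means $M_1\le C\,M_2$ with a universal constant $C$ independent of all parameters and of the problem instance. Cost model (exact real arithmetic). Each of the following takes time $O(\mathsf{T}_{\rm grad})$: evaluating $\nabla f(x)$ at a point; an arithmetic operation (addition, subtraction, multiplication) on two vectors of dimension at most $d$. Procedure $\mathrm{AGD}(g,y_1,\epsilon,L,\sigma)$: set $\kappa=L/\sigma$, $z_1=y_1$. For $j=1,2,\dots$: if $\|\nabla g(y_j)\|\le\epsilon$, return $y_j$; otherwise set $y_{j+1}=z_j-\frac1L\nabla g(z_j)$ and $z_{j+1}=\left(1+\frac{\sqrt\kappa-1}{\sqrt\kappa+1}\right)y_{j+1}-\frac{\sqrt\kappa-1}{\sqrt\kappa+1}y_j$. Procedure $\mathrm{ACAGD}(h,z_1,\epsilon,\gamma,L)$: for $j=1,2,\dots$: if $\|\nabla h(z_j)\|\le\epsilon$, return $z_j$; otherwise let $g_j(z)=h(z)+\gamma\|z-z_j\|^2$, $\epsilon'=\epsilon\sqrt{\gamma/(50(L+2\gamma))}$, and $z_{j+1}=\mathrm{AGD}(g_j,z_j,\epsilon',L+2\gamma,\gamma)$. *)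

theory Defs
  imports Complex_Main "Jordan_Normal_Form.Matrix"
begin

text \<open>
  The space \<open>\<real>\<^sup>d\<close> is \<^term>\<open>carrier_vec d :: real vec set\<close>, so that the dimension is an
  ordinary natural number and a constant can be chosen before it. Objective functions are
  total functions on \<^typ>\<open>real vec\<close>, but only their values on \<^term>\<open>carrier_vec d\<close> matter.
\<close>

definition eucl_norm :: "real vec \<Rightarrow> real" where
  "eucl_norm x = sqrt (x \<bullet> x)"

definition has_gradient :: "nat \<Rightarrow> (real vec \<Rightarrow> real) \<Rightarrow> real vec \<Rightarrow> real vec \<Rightarrow> bool" where
  "has_gradient d f x v \<longleftrightarrow> v \<in> carrier_vec d \<and>
     (\<forall>e>0. \<exists>r>0. \<forall>y\<in>carrier_vec d. eucl_norm (y - x) < r \<longrightarrow>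
        \<bar>f y - f x - v \<bullet> (y - x)\<bar> \<le> e * eucl_norm (y - x))"

definition gradient :: "nat \<Rightarrow> (real vec \<Rightarrow> real) \<Rightarrow> real vec \<Rightarrow> real vec" where
  "gradient d f x = (THE v. has_gradient d f x v)"

definition differentiable_on_space :: "nat \<Rightarrow> (real vec \<Rightarrow> real) \<Rightarrow> bool" where
  "differentiable_on_space d f \<longleftrightarrow> (\<forall>x\<in>carrier_vec d. \<exists>v. has_gradient d f x v)"

definition smooth_fun :: "nat \<Rightarrow> real \<Rightarrow> (real vec \<Rightarrow> real) \<Rightarrow> bool" where
  "smooth_fun d L f \<longleftrightarrow> differentiable_on_space d f \<and>
     (\<forall>x\<in>carrier_vec d. \<forall>y\<in>carrier_vec d.
        eucl_norm (gradient d f x - gradient d f y) \<le> L * eucl_norm (x - y))"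

definition almost_convex :: "nat \<Rightarrow> real \<Rightarrow> (real vec \<Rightarrow> real) \<Rightarrow> bool" where
  "almost_convex d c f \<longleftrightarrow>
     (\<forall>x\<in>carrier_vec d. \<forall>y\<in>carrier_vec d.
        f y \<ge> f x + gradient d f x \<bullet> (y - x) - c / 2 * (eucl_norm (y - x))\<^sup>2)"

text \<open>
  The procedures are given as big-step relations \<open>inputs, returned vector, elapsed time\<close>; a run
  that does not terminate is related to nothing. The parameter \<open>a\<close> is the time of one arithmetic
  operation on vectors of dimension at most \<open>d\<close>. Scalars count as vectors of dimension one, and
  an inner product, a scalar multiple, and a scalar division, square root or comparison are
  charged as one operation each.
\<close>

text \<open>
  Here \<open>c\<close> is the time of one evaluation of the gradient of \<open>g\<close> and
  \<open>\<theta> = (sqrt \<kappa> - 1) / (sqrt \<kappa> + 1)\<close>. The stopping test costs one gradient evaluation and three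
  operations (inner product, square root, comparison). The update costs one further gradient
  evaluation and five operations, the scalars \<open>1 / L\<close> and \<open>1 + \<theta>\<close> being computed in advance.
\<close>

inductive AGD_loop ::
  "nat \<Rightarrow> real \<Rightarrow> real \<Rightarrow> (real vec \<Rightarrow> real) \<Rightarrow> real \<Rightarrow> real \<Rightarrow> real \<Rightarrow>
   real vec \<Rightarrow> real vec \<Rightarrow> real vec \<Rightarrow> real \<Rightarrow> bool"
  for d :: nat and a c :: real and g :: "real vec \<Rightarrow> real" and \<epsilon> L \<theta> :: real
where
  AGD_stop:
    "eucl_norm (gradient d g y) \<le> \<epsilon> \<Longrightarrow> AGD_loop d a c g \<epsilon> L \<theta> y z y (c + 3 * a)"
| AGD_iterate:
    "\<lbrakk> \<not> eucl_norm (gradient d g y) \<le> \<epsilon>;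
       y' = z - (1 / L) \<cdot>\<^sub>v gradient d g z;
       z' = (1 + \<theta>) \<cdot>\<^sub>v y' - \<theta> \<cdot>\<^sub>v y;
       AGD_loop d a c g \<epsilon> L \<theta> y' z' r t \<rbrakk>
     \<Longrightarrow> AGD_loop d a c g \<epsilon> L \<theta> y z r ((c + 3 * a) + (c + 5 * a) + t)"

text \<open>
  Seven scalar operations of preparation:
  \<open>\<kappa>\<close>, \<open>sqrt \<kappa>\<close>, \<open>sqrt \<kappa> - 1\<close>, \<open>sqrt \<kappa> + 1\<close>, \<open>\<theta>\<close>, \<open>1 + \<theta>\<close> and \<open>1 / L\<close>.
\<close>

definition AGD ::
  "nat \<Rightarrow> real \<Rightarrow> real \<Rightarrow> (real vec \<Rightarrow> real) \<Rightarrow> real vec \<Rightarrow> real \<Rightarrow> real \<Rightarrow> real \<Rightarrow>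
   real vec \<Rightarrow> real \<Rightarrow> bool" where
  "AGD d a c g y1 \<epsilon> L \<sigma> r t \<longleftrightarrow>
     (let \<kappa> = L / \<sigma>; \<theta> = (sqrt \<kappa> - 1) / (sqrt \<kappa> + 1)
      in \<exists>s. AGD_loop d a c g \<epsilon> L \<theta> y1 y1 r s \<and> t = 7 * a + s)"

definition prox_fun :: "(real vec \<Rightarrow> real) \<Rightarrow> real \<Rightarrow> real vec \<Rightarrow> real vec \<Rightarrow> real" where
  "prox_fun h \<gamma> w z = h z + \<gamma> * (eucl_norm (z - w))\<^sup>2"

text \<open>
  Here \<open>c\<close> is the time of one evaluation of the gradient of \<open>h\<close>. Since
  \<open>\<nabla>g\<^sub>j(z) = \<nabla>h(z) + 2\<gamma>(z - z\<^sub>j)\<close>, a gradient of \<open>g\<^sub>j\<close> costs one gradient of \<open>h\<close> and three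
  operations. Computing the scalars \<open>2\<gamma>\<close>, \<open>L + 2\<gamma>\<close> and \<open>\<epsilon>'\<close> takes six operations.
\<close>

inductive ACAGD ::
  "nat \<Rightarrow> real \<Rightarrow> real \<Rightarrow> (real vec \<Rightarrow> real) \<Rightarrow> real vec \<Rightarrow> real \<Rightarrow> real \<Rightarrow> real \<Rightarrow>
   real vec \<Rightarrow> real \<Rightarrow> bool"
  for d :: nat and a c :: real and h :: "real vec \<Rightarrow> real"
where
  ACAGD_stop:
    "eucl_norm (gradient d h z) \<le> \<epsilon> \<Longrightarrow> ACAGD d a c h z \<epsilon> \<gamma> L z (c + 3 * a)"
| ACAGD_iterate:
    "\<lbrakk> \<not> eucl_norm (gradient d h z) \<le> \<epsilon>;
       \<epsilon>' = \<epsilon> * sqrt (\<gamma> / (50 * (L + 2 * \<gamma>)));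
       AGD d a (c + 3 * a) (prox_fun h \<gamma> z) z \<epsilon>' (L + 2 * \<gamma>) \<gamma> z' s;
       ACAGD d a c h z' \<epsilon> \<gamma> L r t \<rbrakk>
     \<Longrightarrow> ACAGD d a c h z \<epsilon> \<gamma> L r ((c + 3 * a) + 6 * a + s + t)"

text \<open>
  The relations are single-valued, so a statement about some run is a statement about the run.
\<close>

lemma AGD_loop_unique:
  assumes "AGD_loop d a c g \<epsilon> L \<theta> y z r t" "AGD_loop d a c g \<epsilon> L \<theta> y z r' t'"
  shows "r = r' \<and> t = t'"
  using assms
proof (induction arbitrary: r' t' rule: AGD_loop.induct)
  case (AGD_stop y z)
  from AGD_stop.prems AGD_stop.hyps show ?case
    by (cases rule: AGD_loop.cases) auto
next
  case (AGD_iterate y y' z z' r t)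
  from AGD_iterate.prems show ?case
  proof (cases rule: AGD_loop.cases)
    case AGD_stop
    with AGD_iterate.hyps(1) show ?thesis by blast
  next
    case (AGD_iterate u w t'')
    from AGD_iterate(3,4,5) have "AGD_loop d a c g \<epsilon> L \<theta> y' z' r' t''"
      by (simp only: \<open>y' = _\<close> \<open>z' = _\<close>)
    then have "r = r' \<and> t = t''" by (rule AGD_iterate.IH)
    with AGD_iterate(1) show ?thesis by simp
  qed
qed

lemma AGD_unique:
  assumes "AGD d a c g y \<epsilon> L \<sigma> r t" "AGD d a c g y \<epsilon> L \<sigma> r' t'"
  shows "r = r' \<and> t = t'"
  using assms AGD_loop_unique unfolding AGD_def Let_def by blast

lemma ACAGD_unique:
  assumes "ACAGD d a c h z \<epsilon> \<gamma> L r t" "ACAGD d a c h z \<epsilon> \<gamma> L r' t'"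
  shows "r = r' \<and> t = t'"
  using assms
proof (induction arbitrary: r' t' rule: ACAGD.induct)
  case (ACAGD_stop z \<epsilon> \<gamma> L)
  from ACAGD_stop.prems ACAGD_stop.hyps show ?case
    by (cases rule: ACAGD.cases) auto
next
  case (ACAGD_iterate z \<epsilon> \<epsilon>' \<gamma> L z' s r t)
  from ACAGD_iterate.prems show ?case
  proof (cases rule: ACAGD.cases)
    case ACAGD_stop
    with ACAGD_iterate.hyps show ?thesis by simp
  next
    case (ACAGD_iterate e w s' t'')
    with \<open>\<epsilon>' = _\<close> AGD_unique[OF \<open>AGD d a (c + 3 * a) (prox_fun h \<gamma> z) z \<epsilon>' (L + 2 * \<gamma>) \<gamma> z' s\<close>]
    have "z' = w \<and> s = s'" by simp
    with ACAGD_iterate ACAGD_iterate.IH show ?thesis by auto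
  qed
qed

end

theory Submission
  imports Defs "HOL-Analysis.L2_Norm"
begin

text \<open>
  The proximal function \<open>g = prox_fun f \<gamma> z\<^sub>j\<close> is \<open>\<gamma>\<close>-strongly convex and \<open>(L\<^sub>1 + 2 \<gamma>)\<close>-smooth, so
  accelerated gradient descent contracts a Lyapunov function by the factor
  \<open>1 - sqrt (\<gamma> / (L\<^sub>1 + 2 \<gamma>))\<close> per iteration. This gives the logarithmic bound on the inner
  iterations, and with the starting point as comparison point it gives
  \<open>f z\<^sub>j\<^sub>+\<^sub>1 + \<gamma> \<parallel>z\<^sub>j\<^sub>+\<^sub>1 - z\<^sub>j\<parallel>\<^sup>2 \<le> f z\<^sub>j\<close>. If the outer loop continues at \<open>z\<^sub>j\<^sub>+\<^sub>1\<close>, then the small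
  gradient of \<open>g\<close> and the large gradient of \<open>f\<close> force \<open>\<gamma> \<parallel>z\<^sub>j\<^sub>+\<^sub>1 - z\<^sub>j\<parallel> \<ge> 11 \<epsilon> / 24\<close>, so that \<open>f\<close>
  decreases by at least \<open>\<epsilon>\<^sup>2 / (5 \<gamma>)\<close>. This bounds the number of outer iterations and, summed
  along the run, the distance travelled.
\<close>

section \<open>Euclidean norm\<close>

lemma scalar_prod_eq_sum:
  assumes "y \<in> carrier_vec d"
  shows "x \<bullet> y = (\<Sum>i<d. x $ i * y $ i)"
  using assms by (simp add: scalar_prod_def lessThan_atLeast0)

text \<open>Through this identification the triangle and Cauchy-Schwarz inequalities come from
  \<open>L2_set\<close>.\<close>

lemma eucl_norm_eq_L2_set:
  assumes "x \<in> carrier_vec d"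
  shows "eucl_norm x = L2_set (\<lambda>i. x $ i) {..<d}"
  using assms by (simp add: eucl_norm_def L2_set_def scalar_prod_eq_sum power2_eq_square)

lemma eucl_norm_nonneg: "0 \<le> eucl_norm x"
  by (simp add: eucl_norm_eq_L2_set[of x "dim_vec x"] L2_set_nonneg)

lemma eucl_norm_sq:
  assumes "x \<in> carrier_vec d"
  shows "(eucl_norm x)\<^sup>2 = (\<Sum>i<d. (x $ i)\<^sup>2)"
  using assms by (simp add: eucl_norm_eq_L2_set L2_set_def sum_nonneg)

lemma scalar_prod_self: "x \<bullet> x = (eucl_norm x)\<^sup>2" for x :: "real vec"
  using eucl_norm_sq[of x "dim_vec x"]
  by (simp add: scalar_prod_eq_sum[of x "dim_vec x"] power2_eq_square)

lemma eucl_norm_smult: "eucl_norm (a \<cdot>\<^sub>v x) = \<bar>a\<bar> * eucl_norm x"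
proof -
  have "(a \<cdot>\<^sub>v x) \<bullet> (a \<cdot>\<^sub>v x) = a\<^sup>2 * (x \<bullet> x)"
    by (simp add: power2_eq_square)
  then show ?thesis
    by (simp add: eucl_norm_def real_sqrt_mult)
qed

lemma eucl_norm_triangle:
  assumes "x \<in> carrier_vec d" "y \<in> carrier_vec d"
  shows "eucl_norm (x + y) \<le> eucl_norm x + eucl_norm y"
proof -
  have "eucl_norm (x + y) = L2_set (\<lambda>i. x $ i + y $ i) {..<d}"
    unfolding eucl_norm_eq_L2_set[OF add_carrier_vec[OF assms]]
    using assms by (intro L2_set_cong) auto
  then show ?thesis
    using L2_set_triangle_ineq[of "\<lambda>i. x $ i" "\<lambda>i. y $ i" "{..<d}"] assms
    by (simp add: eucl_norm_eq_L2_set)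
qed

lemma eucl_norm_zero [simp]: "eucl_norm (0\<^sub>v n) = 0"
  by (simp add: eucl_norm_def)

lemma eucl_norm_diff_self: "eucl_norm (x - x) = 0"
proof -
  have "x - x = 0\<^sub>v (dim_vec x)" by auto
  then show ?thesis by (simp only: eucl_norm_zero)
qed

lemma scalar_prod_le_eucl_norm:
  assumes "x \<in> carrier_vec d" "y \<in> carrier_vec d"
  shows "x \<bullet> y \<le> eucl_norm x * eucl_norm y"
proof -
  have "x \<bullet> y \<le> (\<Sum>i<d. \<bar>x $ i\<bar> * \<bar>y $ i\<bar>)"
    unfolding scalar_prod_eq_sum[OF assms(2)] abs_mult[symmetric] by (intro sum_mono) auto
  then show ?thesis
    using L2_set_mult_ineq[of "\<lambda>i. x $ i" "\<lambda>i. y $ i" "{..<d}"] assms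
    by (simp add: eucl_norm_eq_L2_set)
qed

lemma eucl_norm_minus_triangle:
  assumes "x \<in> carrier_vec d" "y \<in> carrier_vec d" "z \<in> carrier_vec d"
  shows "eucl_norm (x - z) \<le> eucl_norm (x - y) + eucl_norm (y - z)"
proof -
  have "x - z = (x - y) + (y - z)" using assms by (intro eq_vecI) auto
  then show ?thesis using assms eucl_norm_triangle[of "x - y" d "y - z"] by simp
qed

section \<open>Gradients\<close>

text \<open>Makes the \<open>THE\<close> in \<open>gradient\<close> meaningful. Along
  \<open>h = v - w\<close> the two linear models drift apart linearly in the step length, while each
  is accurate to first order.\<close>

lemma has_gradient_unique:
  assumes v: "has_gradient d f x v" and w: "has_gradient d f x w" and x: "x \<in> carrier_vec d"
  shows "v = w"
proof (rule ccontr)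
  assume "v \<noteq> w"
  have vw: "v \<in> carrier_vec d" "w \<in> carrier_vec d"
    using v w by (auto simp: has_gradient_def)
  define h where "h = v - w"
  have h: "h \<in> carrier_vec d" using vw by (simp add: h_def)
  have "\<not> eucl_norm h \<le> 0"
  proof
    assume "eucl_norm h \<le> 0"
    then have "eucl_norm h = 0" using eucl_norm_nonneg[of h] by simp
    then have "L2_set (\<lambda>i. h $ i) {..<d} = 0" using h by (simp add: eucl_norm_eq_L2_set)
    then have "\<forall>i<d. h $ i = 0" by (simp add: L2_set_eq_0_iff)
    then have "v = w" using vw by (intro eq_vecI) (auto simp: h_def)
    with \<open>v \<noteq> w\<close> show False ..
  qed
  then have pos: "eucl_norm h > 0" by simp
  \<comment> \<open>With this tolerance the two errors add up to at most half of the discrepancy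
    \<open>t * (eucl_norm h)\<^sup>2\<close>.\<close>
  define e where "e = eucl_norm h / 4"
  have "e > 0" using pos by (simp add: e_def)
  obtain r1 where r1: "r1 > 0" "\<And>y. y \<in> carrier_vec d \<Longrightarrow> eucl_norm (y - x) < r1 \<Longrightarrow>
        \<bar>f y - f x - v \<bullet> (y - x)\<bar> \<le> e * eucl_norm (y - x)"
    using v \<open>e > 0\<close> unfolding has_gradient_def by metis
  obtain r2 where r2: "r2 > 0" "\<And>y. y \<in> carrier_vec d \<Longrightarrow> eucl_norm (y - x) < r2 \<Longrightarrow>
        \<bar>f y - f x - w \<bullet> (y - x)\<bar> \<le> e * eucl_norm (y - x)"
    using w \<open>e > 0\<close> unfolding has_gradient_def by metis
  \<comment> \<open>Places \<open>y\<close> at distance \<open>min r1 r2 / 2\<close> from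
    \<open>x\<close>, inside both neighbourhoods.\<close>
  define t where "t = min r1 r2 / (2 * eucl_norm h)"
  have t: "t > 0" using r1(1) r2(1) pos by (simp add: t_def)
  define y where "y = x + t \<cdot>\<^sub>v h"
  have y: "y \<in> carrier_vec d" using x h by (simp add: y_def)
  have yx: "y - x = t \<cdot>\<^sub>v h" using x h by (intro eq_vecI) (auto simp: y_def)
  have n: "eucl_norm (y - x) = t * eucl_norm h" using t by (simp add: yx eucl_norm_smult)
  have "t * eucl_norm h = min r1 r2 / 2" using pos by (simp add: t_def)
  then have "eucl_norm (y - x) < r1" "eucl_norm (y - x) < r2" using n r1(1) r2(1) by auto
  then have "\<bar>f y - f x - v \<bullet> (y - x)\<bar> \<le> e * (t * eucl_norm h)"
    "\<bar>f y - f x - w \<bullet> (y - x)\<bar> \<le> e * (t * eucl_norm h)"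
    using r1(2)[OF y] r2(2)[OF y] n by auto
  then have "v \<bullet> (y - x) - w \<bullet> (y - x) \<le> 2 * e * (t * eucl_norm h)" by linarith
  moreover have "v \<bullet> (y - x) - w \<bullet> (y - x) = t * (eucl_norm h)\<^sup>2"
  proof -
    have "v \<bullet> (y - x) - w \<bullet> (y - x) = h \<bullet> (t \<cdot>\<^sub>v h)"
      unfolding yx h_def using vw by (subst minus_scalar_prod_distrib) auto
    then show ?thesis using scalar_prod_self[of h] by simp
  qed
  ultimately have "t * (eucl_norm h)\<^sup>2 \<le> t * (eucl_norm h)\<^sup>2 / 2"
    by (simp add: e_def power2_eq_square)
  moreover have "t * (eucl_norm h)\<^sup>2 > 0" using t pos by simp
  ultimately show False by linarith
qed

lemma gradient_eqI:
  assumes "has_gradient d f x v" "x \<in> carrier_vec d"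
  shows "gradient d f x = v"
  unfolding gradient_def using assms has_gradient_unique by blast

lemma has_gradient_gradient:
  assumes "smooth_fun d L f" "x \<in> carrier_vec d"
  shows "has_gradient d f x (gradient d f x)"
proof -
  obtain v where v: "has_gradient d f x v"
    using assms by (auto simp: smooth_fun_def differentiable_on_space_def)
  then show ?thesis using gradient_eqI[OF v assms(2)] by simp
qed

lemma gradient_carrier:
  assumes "smooth_fun d L f" "x \<in> carrier_vec d"
  shows "gradient d f x \<in> carrier_vec d"
  using has_gradient_gradient[OF assms] by (simp add: has_gradient_def)

text \<open>Reduces estimates along a segment to one-variable calculus: moving the parameter by
  \<open>u\<close> moves the point by \<open>u\<close> times \<open>h\<close>, so the error divided
  by \<open>u\<close> stays small.\<close>

lemma has_gradient_line_derivative: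
  assumes g: "has_gradient d f (x + t \<cdot>\<^sub>v h) v" and x: "x \<in> carrier_vec d" and h: "h \<in> carrier_vec d"
  shows "((\<lambda>t. f (x + t \<cdot>\<^sub>v h)) has_real_derivative v \<bullet> h) (at t)"
  unfolding DERIV_def
proof (rule LIM_I)
  fix e :: real assume "e > 0"
  have v: "v \<in> carrier_vec d" using g by (simp add: has_gradient_def)
  \<comment> \<open>The \<open>+ 1\<close> keeps the denominator positive when \<open>h\<close> is
    zero.\<close>
  define e' where "e' = e / (2 * (eucl_norm h + 1))"
  have hn: "eucl_norm h \<ge> 0" by (rule eucl_norm_nonneg)
  have e': "e' > 0" using \<open>e > 0\<close> hn by (simp add: e'_def)
  obtain r where r: "r > 0" "\<And>y. y \<in> carrier_vec d \<Longrightarrow> eucl_norm (y - (x + t \<cdot>\<^sub>v h)) < r \<Longrightarrow>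
        \<bar>f y - f (x + t \<cdot>\<^sub>v h) - v \<bullet> (y - (x + t \<cdot>\<^sub>v h))\<bar> \<le> e' * eucl_norm (y - (x + t \<cdot>\<^sub>v h))"
    using g e' unfolding has_gradient_def by metis
  show "\<exists>s>0. \<forall>u. u \<noteq> 0 \<and> norm (u - 0) < s \<longrightarrow>
      norm ((f (x + (t + u) \<cdot>\<^sub>v h) - f (x + t \<cdot>\<^sub>v h)) / u - v \<bullet> h) < e"
  proof (intro exI[of _ "r / (eucl_norm h + 1)"] conjI allI impI)
    show "0 < r / (eucl_norm h + 1)" using r(1) hn by simp
    fix u :: real assume u: "u \<noteq> 0 \<and> norm (u - 0) < r / (eucl_norm h + 1)"
    define y where "y = x + (t + u) \<cdot>\<^sub>v h"
    have y: "y \<in> carrier_vec d" using x h by (simp add: y_def)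
    have yx: "y - (x + t \<cdot>\<^sub>v h) = u \<cdot>\<^sub>v h"
      using x h by (intro eq_vecI) (auto simp: y_def algebra_simps)
    have n: "eucl_norm (y - (x + t \<cdot>\<^sub>v h)) = \<bar>u\<bar> * eucl_norm h" by (simp add: yx eucl_norm_smult)
    have "\<bar>u\<bar> * (eucl_norm h + 1) < r" using u hn by (simp add: pos_less_divide_eq)
    then have "\<bar>u\<bar> * eucl_norm h < r" by (simp add: distrib_left)
    then have "\<bar>f y - f (x + t \<cdot>\<^sub>v h) - v \<bullet> (u \<cdot>\<^sub>v h)\<bar> \<le> e' * (\<bar>u\<bar> * eucl_norm h)"
      using r(2)[OF y] n yx by simp
    moreover have "v \<bullet> (u \<cdot>\<^sub>v h) = u * (v \<bullet> h)" using v h by simp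
    ultimately have "\<bar>f y - f (x + t \<cdot>\<^sub>v h) - u * (v \<bullet> h)\<bar> \<le> \<bar>u\<bar> * (e' * eucl_norm h)"
      by (simp add: mult_ac)
    moreover have "(f y - f (x + t \<cdot>\<^sub>v h)) / u - v \<bullet> h = (f y - f (x + t \<cdot>\<^sub>v h) - u * (v \<bullet> h)) / u"
      using u by (simp add: field_simps)
    ultimately have "\<bar>(f y - f (x + t \<cdot>\<^sub>v h)) / u - v \<bullet> h\<bar> \<le> e' * eucl_norm h"
      using u by (simp add: abs_divide pos_divide_le_eq mult.commute)
    also have "e' * eucl_norm h < e"
    proof -
      have "e * eucl_norm h < e * (2 * (eucl_norm h + 1))" using \<open>e > 0\<close> hn by simp
      then show ?thesis using hn by (simp add: e'_def pos_divide_less_eq)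
    qed
    finally show "norm ((f (x + (t + u) \<cdot>\<^sub>v h) - f (x + t \<cdot>\<^sub>v h)) / u - v \<bullet> h) < e"
      by (simp add: y_def)
  qed
qed

text \<open>The descent lemma. Subtracting the linear and quadratic terms along the segment leaves
  \<open>\<psi>\<close>, whose derivative is nonpositive by Cauchy-Schwarz and the Lipschitz bound;
  comparing \<open>\<psi>\<close> at 0 and 1 replaces integration.\<close>

lemma smooth_fun_quadratic_upper_bound:
  assumes f: "smooth_fun d L f" and x: "x \<in> carrier_vec d" and y: "y \<in> carrier_vec d"
  shows "f y \<le> f x + gradient d f x \<bullet> (y - x) + L / 2 * (eucl_norm (y - x))\<^sup>2"
proof -
  define h where "h = y - x"
  have h: "h \<in> carrier_vec d" using x y by (simp add: h_def)
  let ?G = "\<lambda>t. gradient d f (x + t \<cdot>\<^sub>v h)"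
  define \<psi> where
    "\<psi> t = f (x + t \<cdot>\<^sub>v h) - t * (gradient d f x \<bullet> h) - L / 2 * t\<^sup>2 * (eucl_norm h)\<^sup>2" for t
  have "\<psi> 1 \<le> \<psi> 0"
  proof (rule DERIV_nonpos_imp_nonincreasing[of 0 1 \<psi>])
    fix t :: real assume t: "0 \<le> t"
    have xt: "x + t \<cdot>\<^sub>v h \<in> carrier_vec d" using x h by simp
    have G: "?G t \<in> carrier_vec d" "gradient d f x \<in> carrier_vec d"
      using gradient_carrier[OF f] xt x by auto
    have "(\<psi> has_real_derivative
        ?G t \<bullet> h - gradient d f x \<bullet> h - L * t * (eucl_norm h)\<^sup>2) (at t)"
      unfolding \<psi>_def
      by (rule derivative_eq_intros
          has_gradient_line_derivative[OF has_gradient_gradient[OF f xt] x h] refl)+ simp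
    moreover have "?G t \<bullet> h - gradient d f x \<bullet> h \<le> L * t * (eucl_norm h)\<^sup>2"
    proof -
      have "?G t \<bullet> h - gradient d f x \<bullet> h = (?G t - gradient d f x) \<bullet> h"
        using G h by (simp add: minus_scalar_prod_distrib)
      also have "\<dots> \<le> eucl_norm (?G t - gradient d f x) * eucl_norm h"
        using G h by (intro scalar_prod_le_eucl_norm) auto
      also have "\<dots> \<le> (L * eucl_norm (x + t \<cdot>\<^sub>v h - x)) * eucl_norm h"
        using f x xt eucl_norm_nonneg by (intro mult_right_mono) (auto simp: smooth_fun_def)
      also have "x + t \<cdot>\<^sub>v h - x = t \<cdot>\<^sub>v h" using x h by (intro eq_vecI) auto
      finally show ?thesis using t by (simp add: eucl_norm_smult power2_eq_square mult_ac)
    qed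
    ultimately show "\<exists>D. (\<psi> has_real_derivative D) (at t) \<and> D \<le> 0" by auto
  qed simp
  moreover have "x + 1 \<cdot>\<^sub>v h = y" "x + 0 \<cdot>\<^sub>v h = x" using x y by (auto intro!: eq_vecI simp: h_def)
  ultimately show ?thesis by (simp add: \<psi>_def h_def)
qed

section \<open>Calculus of the proximal function\<close>

text \<open>Exact second-order expansion of the proximal term at \<open>x\<close>, checked by
  coordinates. The vector \<open>G\<close> is carried along so that, for \<open>G\<close> the
  gradient of \<open>f\<close>, the gradient of the proximal function appears in a single inner
  product.\<close>

lemma prox_quadratic_expansion:
  assumes "x \<in> carrier_vec d" "y \<in> carrier_vec d" "w \<in> carrier_vec d" "G \<in> carrier_vec d"
  shows "\<gamma> * (eucl_norm (y - w))\<^sup>2 + G \<bullet> (y - x)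
    = \<gamma> * (eucl_norm (x - w))\<^sup>2 + (G + (2 * \<gamma>) \<cdot>\<^sub>v (x - w)) \<bullet> (y - x) + \<gamma> * (eucl_norm (y - x))\<^sup>2"
proof -
  have c: "y - w \<in> carrier_vec d" "x - w \<in> carrier_vec d" "y - x \<in> carrier_vec d"
    using assms by auto
  show ?thesis
    unfolding eucl_norm_sq[OF c(1)] eucl_norm_sq[OF c(2)] eucl_norm_sq[OF c(3)]
      scalar_prod_eq_sum[OF c(3)] sum_distrib_left sum.distrib[symmetric]
    using assms by (intro sum.cong) (auto simp: algebra_simps power2_eq_square)
qed

text \<open>The expansion is exact, so the remainder is that of \<open>f\<close> plus \<gamma> times
  the squared distance; each gets half of the tolerance \<open>e\<close>, the second because of the
  radius \<open>e / (2 * \<gamma>)\<close>.\<close>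

lemma has_gradient_prox_fun:
  assumes f: "has_gradient d f x v" and x: "x \<in> carrier_vec d" and w: "w \<in> carrier_vec d"
    and "\<gamma> > 0"
  shows "has_gradient d (prox_fun f \<gamma> w) x (v + (2 * \<gamma>) \<cdot>\<^sub>v (x - w))"
  unfolding has_gradient_def
proof (intro conjI allI impI)
  have v: "v \<in> carrier_vec d" using f by (simp add: has_gradient_def)
  then show "v + (2 * \<gamma>) \<cdot>\<^sub>v (x - w) \<in> carrier_vec d" using x w by simp
  fix e :: real assume "e > 0"
  then have "e / 2 > 0" by simp
  then obtain r where r: "r > 0" "\<And>y. y \<in> carrier_vec d \<Longrightarrow> eucl_norm (y - x) < r \<Longrightarrow>
        \<bar>f y - f x - v \<bullet> (y - x)\<bar> \<le> e / 2 * eucl_norm (y - x)"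
    using f unfolding has_gradient_def by metis
  show "\<exists>r>0. \<forall>y\<in>carrier_vec d. eucl_norm (y - x) < r \<longrightarrow>
      \<bar>prox_fun f \<gamma> w y - prox_fun f \<gamma> w x - (v + (2 * \<gamma>) \<cdot>\<^sub>v (x - w)) \<bullet> (y - x)\<bar>
        \<le> e * eucl_norm (y - x)"
  proof (intro exI[of _ "min r (e / (2 * \<gamma>))"] conjI ballI impI)
    show "0 < min r (e / (2 * \<gamma>))" using r(1) \<open>e > 0\<close> \<open>\<gamma> > 0\<close> by simp
    fix y assume y: "y \<in> carrier_vec d" and n: "eucl_norm (y - x) < min r (e / (2 * \<gamma>))"
    have "prox_fun f \<gamma> w y - prox_fun f \<gamma> w x - (v + (2 * \<gamma>) \<cdot>\<^sub>v (x - w)) \<bullet> (y - x)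
        = (f y - f x - v \<bullet> (y - x)) + \<gamma> * (eucl_norm (y - x))\<^sup>2"
      using prox_quadratic_expansion[OF x y w v, of \<gamma>] by (simp add: prox_fun_def)
    moreover have "\<bar>f y - f x - v \<bullet> (y - x)\<bar> \<le> e / 2 * eucl_norm (y - x)"
      using r(2)[OF y] n by simp
    moreover have "\<gamma> * (eucl_norm (y - x))\<^sup>2 \<le> e / 2 * eucl_norm (y - x)"
    proof -
      have "\<gamma> * eucl_norm (y - x) \<le> e / 2" using n \<open>\<gamma> > 0\<close> by (simp add: field_simps)
      from mult_right_mono[OF this eucl_norm_nonneg[of "y - x"]] show ?thesis
        by (simp add: power2_eq_square)
    qed
    moreover have "\<gamma> * (eucl_norm (y - x))\<^sup>2 \<ge> 0" using \<open>\<gamma> > 0\<close> by simp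
    ultimately show "\<bar>prox_fun f \<gamma> w y - prox_fun f \<gamma> w x - (v + (2 * \<gamma>) \<cdot>\<^sub>v (x - w)) \<bullet> (y - x)\<bar>
        \<le> e * eucl_norm (y - x)" by linarith
  qed
qed

section \<open>Accelerated gradient descent\<close>

text \<open>Smoothness and strong convexity enter the analysis as these two quadratic bounds. The
  strict inequality \<open>\<sigma> < L\<close> gives \<open>rate < 1\<close>.\<close>

locale strongly_convex_smooth =
  fixes d :: nat and g :: "real vec \<Rightarrow> real" and L \<sigma> :: real
  assumes \<sigma>_pos: "0 < \<sigma>" and \<sigma>_less: "\<sigma> < L"
    and grad_carrier: "\<And>x. x \<in> carrier_vec d \<Longrightarrow> gradient d g x \<in> carrier_vec d"
    and upper: "\<And>x y. x \<in> carrier_vec d \<Longrightarrow> y \<in> carrier_vec d \<Longrightarrow>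
      g y \<le> g x + gradient d g x \<bullet> (y - x) + L / 2 * (eucl_norm (y - x))\<^sup>2"
    and lower: "\<And>x y. x \<in> carrier_vec d \<Longrightarrow> y \<in> carrier_vec d \<Longrightarrow>
      g x + gradient d g x \<bullet> (y - x) + \<sigma> / 2 * (eucl_norm (y - x))\<^sup>2 \<le> g y"
begin

text \<open>With \<kappa> = L / \<sigma> this is 1 / sqrt \<kappa>; each iteration shrinks the
  potential by the factor \<open>1 - rate\<close>.\<close>

definition rate :: real where "rate = sqrt (\<sigma> / L)"

text \<open>The weights make \<open>z\<close> the convex combination \<open>(y + rate w) / (1 + rate)\<close> of \<open>y\<close> and the
  mirror point \<open>w\<close>.\<close>

definition mirror_point :: "real vec \<Rightarrow> real vec \<Rightarrow> real vec" where
  "mirror_point y z = (1 + 1 / rate) \<cdot>\<^sub>v z - (1 / rate) \<cdot>\<^sub>v y"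

text \<open>The comparison point \<open>u\<close> is arbitrary, so no minimizer of \<open>g\<close> is needed.\<close>

definition potential :: "real vec \<Rightarrow> real vec \<Rightarrow> real vec \<Rightarrow> real" where
  "potential u y z = g y - g u + \<sigma> / 2 * (eucl_norm (mirror_point y z - u))\<^sup>2"

lemma L_pos: "0 < L"
  using \<sigma>_pos \<sigma>_less by linarith

lemma rate_pos: "0 < rate" and rate_less_1: "rate < 1" and rate_sq: "\<sigma> = rate\<^sup>2 * L"
  using \<sigma>_pos \<sigma>_less by (auto simp: rate_def)

lemma momentum_eq: "(sqrt (L / \<sigma>) - 1) / (sqrt (L / \<sigma>) + 1) = (1 - rate) / (1 + rate)"
proof -
  have "sqrt (L / \<sigma>) = 1 / rate" by (simp add: rate_def real_sqrt_divide)
  moreover have "1 / rate - 1 = (1 - rate) / rate" "1 / rate + 1 = (1 + rate) / rate"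
    using rate_pos by (auto simp: field_simps)
  ultimately show ?thesis using rate_pos by simp
qed

text \<open>The step length \<open>1 / L\<close> minimizes the quadratic upper model along the
  negative gradient.\<close>

lemma gradient_step_decrease:
  assumes "x \<in> carrier_vec d"
  shows "g (x - (1 / L) \<cdot>\<^sub>v gradient d g x) \<le> g x - (eucl_norm (gradient d g x))\<^sup>2 / (2 * L)"
proof -
  let ?G = "gradient d g x"
  have G: "?G \<in> carrier_vec d" using grad_carrier assms .
  have "x - (1 / L) \<cdot>\<^sub>v ?G - x = (- 1 / L) \<cdot>\<^sub>v ?G" using assms G by (intro eq_vecI) auto
  moreover have "?G \<bullet> ((- 1 / L) \<cdot>\<^sub>v ?G) = (- 1 / L) * (eucl_norm ?G)\<^sup>2"
    by (simp add: scalar_prod_self)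
  moreover have "(eucl_norm ((- 1 / L) \<cdot>\<^sub>v ?G))\<^sup>2 = (eucl_norm ?G)\<^sup>2 / L\<^sup>2"
    using L_pos by (simp add: eucl_norm_smult power_divide)
  ultimately show ?thesis
    using upper[OF assms, of "x - (1 / L) \<cdot>\<^sub>v ?G"] assms G L_pos
    by (simp add: power2_eq_square field_simps)
qed

text \<open>One coordinate of the estimate for the mirror point. All terms are sums over
  coordinates, so the vector version follows by summation.\<close>

lemma momentum_step_scalar:
  fixes u y z G :: real
  defines "y' \<equiv> z - (1 / L) * G"
  defines "z' \<equiv> (1 + (1 - rate) / (1 + rate)) * y' - ((1 - rate) / (1 + rate)) * y"
  shows "\<sigma> / 2 * ((1 + 1 / rate) * z' - (1 / rate) * y' - u)\<^sup>2
    \<le> (1 - rate) * (\<sigma> / 2) * ((1 + 1 / rate) * z - (1 / rate) * y - u)\<^sup>2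
      + rate * (\<sigma> / 2) * (u - z)\<^sup>2 + (1 - rate) * (G * (y - z)) + rate * (G * (u - z))
      + 1 / (2 * L) * G\<^sup>2"
proof -
  define s where "s = rate"
  have s: "0 < s" "s < 1" using rate_pos rate_less_1 by (auto simp: s_def)
  have \<sigma>: "\<sigma> = s\<^sup>2 * L" unfolding s_def by (rule rate_sq)
  define p where "p = (z - y) / s"
  define q where "q = z - u"
  \<comment> \<open>The displacement of the mirror point caused by the gradient, scaled so that
    \<open>\<sigma> * H = s * G\<close>.\<close>
  define H where "H = G / (s * L)"
  have G: "G = s * L * H" using s L_pos by (simp add: H_def)
  have y: "y = z - s * p" using s by (simp add: p_def)
  have u: "u = z - q" by (simp add: q_def)
  have w: "(1 + 1 / s) * z - (1 / s) * y - u = p + q"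
    using s by (simp add: y u field_simps)
  \<comment> \<open>The momentum coefficient is chosen for this identity: the new mirror point is
    the average of the old one and \<open>z\<close> with weights \<open>1 - s\<close> and
    \<open>s\<close>, shifted by \<open>- H\<close>.\<close>
  have w': "(1 + 1 / s) * z' - (1 / s) * y' - u = (1 - s) * p + q - H"
  proof -
    define \<theta> where "\<theta> = (1 - s) / (1 + s)"
    have \<theta>: "(1 + s) * \<theta> = 1 - s" using s by (simp add: \<theta>_def)
    have "(1 + s) * z' = ((1 + s) + (1 + s) * \<theta>) * y' - ((1 + s) * \<theta>) * y"
      unfolding z'_def s_def[symmetric] \<theta>_def[symmetric] by (simp add: algebra_simps)
    then have z': "(1 + s) * z' = 2 * y' - (1 - s) * y" by (simp add: \<theta>)
    have y': "y' = z - s * H" using L_pos by (simp add: y'_def G)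
    have "s * ((1 + 1 / s) * z' - (1 / s) * y' - u) = (1 + s) * z' - y' - s * u"
      using s by (simp add: field_simps)
    also have "\<dots> = s * ((1 - s) * p + q - H)"
      unfolding z' by (simp add: y' y u algebra_simps)
    finally show ?thesis using s by simp
  qed
  \<comment> \<open>Convexity of the square for that average, with the exact gap on the
    right.\<close>
  have "(1 - s) * (p + q)\<^sup>2 + s * q\<^sup>2 - ((1 - s) * p + q)\<^sup>2 = s * (1 - s) * p\<^sup>2"
    by (simp add: power2_eq_square algebra_simps)
  moreover have "0 \<le> s * (1 - s) * p\<^sup>2" using s by simp
  ultimately have "((1 - s) * p + q)\<^sup>2 \<le> (1 - s) * (p + q)\<^sup>2 + s * q\<^sup>2" by linarith
  then have "((1 - s) * p + q - H)\<^sup>2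
      \<le> (1 - s) * (p + q)\<^sup>2 + s * q\<^sup>2 - 2 * H * ((1 - s) * p + q) + H\<^sup>2"
    by (simp add: power2_eq_square algebra_simps)
  then have "\<sigma> / 2 * ((1 - s) * p + q - H)\<^sup>2
      \<le> \<sigma> / 2 * ((1 - s) * (p + q)\<^sup>2 + s * q\<^sup>2 - 2 * H * ((1 - s) * p + q) + H\<^sup>2)"
    using \<sigma>_pos by simp
  \<comment> \<open>As \<open>\<sigma> * H = s * G\<close>, the cross terms become the two gradient
    terms, and the square of \<open>H\<close> becomes the amount that the gradient step
    gains.\<close>
  also have "\<dots> = (1 - s) * (\<sigma> / 2) * (p + q)\<^sup>2 + s * (\<sigma> / 2) * q\<^sup>2
      + (1 - s) * (G * (y - z)) + s * (G * (u - z)) + 1 / (2 * L) * G\<^sup>2"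
  proof -
    have 1: "1 / (2 * L) * G\<^sup>2 = \<sigma> / 2 * H\<^sup>2"
      using L_pos by (simp add: G \<sigma> power2_eq_square)
    have 2: "G * (y - z) = - \<sigma> * H * p"
      by (simp add: G \<sigma> y power2_eq_square)
    have 3: "s * (G * (u - z)) = - \<sigma> * H * q"
      by (simp add: G \<sigma> u power2_eq_square)
    show ?thesis unfolding 1 2 3 by (simp add: field_simps)
  qed
  finally show ?thesis
    unfolding s_def[symmetric] w w' by (simp add: u power2_commute)
qed

text \<open>In the summed coordinate estimate, the decrease of the gradient step cancels the squared
  gradient. Strong convexity towards \<open>u\<close> with weight \<open>rate\<close>, and convexity
  towards \<open>y\<close> with weight \<open>1 - rate\<close>, absorb the inner products.\<close>

lemma potential_step:
  fixes y z u :: "real vec"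
  assumes y: "y \<in> carrier_vec d" and z: "z \<in> carrier_vec d" and u: "u \<in> carrier_vec d"
  defines "y' \<equiv> z - (1 / L) \<cdot>\<^sub>v gradient d g z"
  defines "z' \<equiv> (1 + (1 - rate) / (1 + rate)) \<cdot>\<^sub>v y' - ((1 - rate) / (1 + rate)) \<cdot>\<^sub>v y"
  shows "potential u y' z' \<le> (1 - rate) * potential u y z"
proof -
  let ?G = "gradient d g z"
  have G: "?G \<in> carrier_vec d" using grad_carrier z .
  have y': "y' \<in> carrier_vec d" using z G by (simp add: y'_def)
  have z': "z' \<in> carrier_vec d" using y y' by (simp add: z'_def)
  have c: "mirror_point y' z' - u \<in> carrier_vec d" "mirror_point y z - u \<in> carrier_vec d"
    "u - z \<in> carrier_vec d" "y - z \<in> carrier_vec d"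
    using y z u y' z' by (auto simp: mirror_point_def)
  have "\<sigma> / 2 * (eucl_norm (mirror_point y' z' - u))\<^sup>2
      \<le> (1 - rate) * (\<sigma> / 2) * (eucl_norm (mirror_point y z - u))\<^sup>2
        + rate * (\<sigma> / 2) * (eucl_norm (u - z))\<^sup>2 + (1 - rate) * (?G \<bullet> (y - z))
        + rate * (?G \<bullet> (u - z)) + 1 / (2 * L) * (eucl_norm ?G)\<^sup>2"
    unfolding eucl_norm_sq[OF c(1)] eucl_norm_sq[OF c(2)] eucl_norm_sq[OF c(3)] eucl_norm_sq[OF G]
      scalar_prod_eq_sum[OF c(3)] scalar_prod_eq_sum[OF c(4)] sum_distrib_left sum.distrib[symmetric]
  proof (rule sum_mono)
    fix i assume "i \<in> {..<d}"
    then have i: "i < d" by simp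
    show "\<sigma> / 2 * ((mirror_point y' z' - u) $ i)\<^sup>2
      \<le> (1 - rate) * (\<sigma> / 2) * ((mirror_point y z - u) $ i)\<^sup>2
        + rate * (\<sigma> / 2) * ((u - z) $ i)\<^sup>2 + (1 - rate) * (?G $ i * (y - z) $ i)
        + rate * (?G $ i * (u - z) $ i) + 1 / (2 * L) * (?G $ i)\<^sup>2"
      using momentum_step_scalar[of "z $ i" "?G $ i" "y $ i" "u $ i"] i y z u G y' z'
      by (simp add: mirror_point_def z'_def y'_def)
  qed
  moreover have "g y' \<le> g z - (eucl_norm ?G)\<^sup>2 / (2 * L)"
    unfolding y'_def by (rule gradient_step_decrease[OF z])
  moreover have "rate * (g z + ?G \<bullet> (u - z) + \<sigma> / 2 * (eucl_norm (u - z))\<^sup>2) \<le> rate * g u"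
    using lower[OF z u] rate_pos by simp
  moreover have "(1 - rate) * (g z + ?G \<bullet> (y - z)) \<le> (1 - rate) * g y"
  proof (rule mult_left_mono)
    have "0 \<le> \<sigma> / 2 * (eucl_norm (y - z))\<^sup>2" using \<sigma>_pos by simp
    with lower[OF z y] show "g z + ?G \<bullet> (y - z) \<le> g y" by linarith
  qed (use rate_less_1 in simp)
  ultimately show ?thesis
    by (simp add: potential_def algebra_simps)
qed

section \<open>Consequences of the decay of the potential\<close>

lemma potential_start:
  assumes "y \<in> carrier_vec d"
  shows "potential u y y = g y - g u + \<sigma> / 2 * (eucl_norm (y - u))\<^sup>2"
proof -
  have "mirror_point y y = y"
    using assms by (intro eq_vecI) (auto simp: mirror_point_def algebra_simps)
  then show ?thesis by (simp add: potential_def)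
qed

text \<open>With the start itself as comparison point the initial potential is zero, so the
  hypothesis makes the current potential nonpositive whatever \<open>q\<close> is.\<close>

lemma le_start_if_potential_le:
  assumes y1: "y\<^sub>1 \<in> carrier_vec d" and V: "potential y\<^sub>1 y z \<le> q * potential y\<^sub>1 y\<^sub>1 y\<^sub>1"
  shows "g y \<le> g y\<^sub>1"
proof -
  have "potential y\<^sub>1 y\<^sub>1 y\<^sub>1 = 0" using y1 by (simp add: potential_start eucl_norm_diff_self)
  moreover have "0 \<le> \<sigma> / 2 * (eucl_norm (mirror_point y z - y\<^sub>1))\<^sup>2" using \<sigma>_pos by simp
  moreover have "potential y\<^sub>1 y z = g y - g y\<^sub>1 + \<sigma> / 2 * (eucl_norm (mirror_point y z - y\<^sub>1))\<^sup>2"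
    by (simp add: potential_def)
  ultimately show ?thesis using V by simp
qed

text \<open>Adding the strong convexity bounds at the midpoint of \<open>x\<close> and \<open>u\<close> removes the gradient.\<close>

lemma dist_sq_le_gap:
  assumes x: "x \<in> carrier_vec d" and u: "u \<in> carrier_vec d" and "g u \<le> g x"
    and D: "\<And>y. y \<in> carrier_vec d \<Longrightarrow> g x - g y \<le> D"
  shows "\<sigma> / 2 * (eucl_norm (x - u))\<^sup>2 \<le> 4 * D"
proof -
  define m where "m = (1 / 2) \<cdot>\<^sub>v (x + u)"
  define h where "h = (1 / 2) \<cdot>\<^sub>v (x - u)"
  have m: "m \<in> carrier_vec d" and h: "h \<in> carrier_vec d" using x u by (auto simp: m_def h_def)
  have xm: "x - m = h" and um: "u - m = - h"
    using x u by (auto intro!: eq_vecI simp: m_def h_def field_simps)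
  have G: "gradient d g m \<in> carrier_vec d" using grad_carrier m .
  have n: "eucl_norm h = eucl_norm (x - u) / 2" by (simp add: h_def eucl_norm_smult)
  have "- h = (- 1) \<cdot>\<^sub>v h" by auto
  then have n': "eucl_norm (- h) = eucl_norm (x - u) / 2" by (simp add: eucl_norm_smult n)
  have "gradient d g m \<bullet> (- h) = - (gradient d g m \<bullet> h)" using G h by simp
  then have "2 * g m + \<sigma> / 4 * (eucl_norm (x - u))\<^sup>2 \<le> g x + g u"
    using lower[OF m x] lower[OF m u] by (simp add: xm um n n' power_divide)
  \<comment> \<open>The right side is at most \<open>2 * g x\<close>, and \<open>g x - g m\<close>
    is at most \<open>D\<close>; doubling turns the resulting \<open>2 * D\<close> into
    \<open>4 * D\<close>.\<close>
  then show ?thesis using D[OF m] \<open>g u \<le> g x\<close> by simp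
qed

text \<open>Comparing with the gradient step \<open>u\<close> from \<open>y\<close> itself turns the
  potential into a bound on the gradient at \<open>y\<close>. The initial potential relative to
  \<open>u\<close> is at most \<open>D + 4 * D\<close>, and multiplying by \<open>2 * L\<close>
  gives the factor 10.\<close>

lemma gradient_norm_if_potential_le:
  assumes y1: "y\<^sub>1 \<in> carrier_vec d" and y: "y \<in> carrier_vec d"
    and D: "\<And>y. y \<in> carrier_vec d \<Longrightarrow> g y\<^sub>1 - g y \<le> D"
    and q: "0 \<le> q" and V: "\<And>u. u \<in> carrier_vec d \<Longrightarrow> potential u y z \<le> q * potential u y\<^sub>1 y\<^sub>1"
  shows "(eucl_norm (gradient d g y))\<^sup>2 \<le> 10 * L * q * D"
proof -
  let ?G = "gradient d g y"
  define u where "u = y - (1 / L) \<cdot>\<^sub>v ?G"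
  have u: "u \<in> carrier_vec d" using y grad_carrier[OF y] by (simp add: u_def)
  have dec: "g u \<le> g y - (eucl_norm ?G)\<^sup>2 / (2 * L)"
    unfolding u_def by (rule gradient_step_decrease[OF y])
  moreover have "0 \<le> (eucl_norm ?G)\<^sup>2 / (2 * L)" using L_pos by simp
  ultimately have "g u \<le> g y\<^sub>1" using le_start_if_potential_le[OF y1 V[OF y1]] by linarith
  then have "\<sigma> / 2 * (eucl_norm (y\<^sub>1 - u))\<^sup>2 \<le> 4 * D" using dist_sq_le_gap[OF y1 u _ D] by blast
  then have "potential u y\<^sub>1 y\<^sub>1 \<le> 5 * D"
    using D[OF u] by (simp add: potential_start[OF y1])
  then have "potential u y z \<le> q * (5 * D)" using V[OF u] q mult_left_mono order_trans by blast
  moreover have "0 \<le> \<sigma> / 2 * (eucl_norm (mirror_point y z - u))\<^sup>2" using \<sigma>_pos by simp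
  ultimately have "(eucl_norm ?G)\<^sup>2 / (2 * L) \<le> q * (5 * D)"
    using dec unfolding potential_def by linarith
  then show ?thesis using L_pos by (simp add: field_simps)
qed

text \<open>Induction on the number \<open>n\<close> of iterations still allowed after
  \<open>k\<close> have been made. The invariant holds for every \<open>u\<close> because the
  comparison point depends on the iterate at which the run ends.\<close>

lemma AGD_loop_terminates:
  assumes y1: "y\<^sub>1 \<in> carrier_vec d"
    and D: "\<And>y. y \<in> carrier_vec d \<Longrightarrow> g y\<^sub>1 - g y \<le> D"
    and N: "10 * L * (1 - rate) ^ (k + n) * D \<le> \<epsilon>\<^sup>2" and "\<epsilon> > 0" and "a \<ge> 0" and "c \<ge> 0"
    and y: "y \<in> carrier_vec d" and z: "z \<in> carrier_vec d"
    and V: "\<And>u. u \<in> carrier_vec d \<Longrightarrow> potential u y z \<le> (1 - rate) ^ k * potential u y\<^sub>1 y\<^sub>1"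
  shows "\<exists>r t. AGD_loop d a c g \<epsilon> L ((1 - rate) / (1 + rate)) y z r t \<and> r \<in> carrier_vec d
    \<and> eucl_norm (gradient d g r) \<le> \<epsilon> \<and> g r \<le> g y\<^sub>1 \<and> t \<le> real n * (2 * c + 8 * a) + (c + 3 * a)"
  using N y z V
proof (induction n arbitrary: k y z)
  case 0
  \<comment> \<open>With no iterations left, the accumulated contraction alone forces the stopping
    test to succeed.\<close>
  have "(eucl_norm (gradient d g y))\<^sup>2 \<le> 10 * L * (1 - rate) ^ k * D"
    by (rule gradient_norm_if_potential_le[OF y1 0(2) D _ 0(4)]) (use rate_less_1 in simp_all)
  also have "\<dots> \<le> \<epsilon>\<^sup>2" using 0(1) by simp
  finally have "eucl_norm (gradient d g y) \<le> \<epsilon>"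
    by (rule power2_le_imp_le) (use \<open>\<epsilon> > 0\<close> in simp)
  moreover have "g y \<le> g y\<^sub>1" using le_start_if_potential_le[OF y1 0(4)[OF y1]] .
  moreover have "AGD_loop d a c g \<epsilon> L ((1 - rate) / (1 + rate)) y z y (c + 3 * a)"
    using \<open>eucl_norm (gradient d g y) \<le> \<epsilon>\<close> by (rule AGD_stop)
  ultimately show ?case using 0(2) by (intro exI[of _ y] exI[of _ "c + 3 * a"] conjI) simp_all
next
  case (Suc n)
  show ?case
  proof (cases "eucl_norm (gradient d g y) \<le> \<epsilon>")
    case True
    then have "AGD_loop d a c g \<epsilon> L ((1 - rate) / (1 + rate)) y z y (c + 3 * a)"
      by (rule AGD_stop)
    moreover have "g y \<le> g y\<^sub>1" using le_start_if_potential_le[OF y1 Suc.prems(4)[OF y1]] .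
    moreover have "c + 3 * a \<le> real (Suc n) * (2 * c + 8 * a) + (c + 3 * a)"
      using \<open>a \<ge> 0\<close> \<open>c \<ge> 0\<close> by simp
    ultimately show ?thesis using True Suc.prems(2)
      by (intro exI[of _ y] exI[of _ "c + 3 * a"] conjI)
  next
    case False
    define \<theta> where "\<theta> = (1 - rate) / (1 + rate)"
    define y' where "y' = z - (1 / L) \<cdot>\<^sub>v gradient d g z"
    define z' where "z' = (1 + \<theta>) \<cdot>\<^sub>v y' - \<theta> \<cdot>\<^sub>v y"
    have y': "y' \<in> carrier_vec d" using grad_carrier Suc.prems(3) by (simp add: y'_def)
    have z': "z' \<in> carrier_vec d" using y' Suc.prems(2) by (simp add: z'_def)
    have V': "potential u y' z' \<le> (1 - rate) ^ Suc k * potential u y\<^sub>1 y\<^sub>1"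
      if u: "u \<in> carrier_vec d" for u
    proof -
      have "potential u y' z' \<le> (1 - rate) * potential u y z"
        unfolding y'_def z'_def \<theta>_def using Suc.prems(2,3) u by (rule potential_step)
      also have "\<dots> \<le> (1 - rate) * ((1 - rate) ^ k * potential u y\<^sub>1 y\<^sub>1)"
        using Suc.prems(4)[OF u] rate_less_1 by (intro mult_left_mono) auto
      finally show ?thesis by simp
    qed
    have N': "10 * L * (1 - rate) ^ (Suc k + n) * D \<le> \<epsilon>\<^sup>2" using Suc.prems(1) by simp
    from Suc.IH[OF N' y' z' V'] obtain r t where r: "AGD_loop d a c g \<epsilon> L \<theta> y' z' r t" "r \<in> carrier_vec d"
      "eucl_norm (gradient d g r) \<le> \<epsilon>" "g r \<le> g y\<^sub>1"
      "t \<le> real n * (2 * c + 8 * a) + (c + 3 * a)"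
      unfolding \<theta>_def by blast
    have "AGD_loop d a c g \<epsilon> L \<theta> y z r ((c + 3 * a) + (c + 5 * a) + t)"
      using False y'_def z'_def r(1) by (rule AGD_iterate)
    moreover have "(c + 3 * a) + (c + 5 * a) + t \<le> real (Suc n) * (2 * c + 8 * a) + (c + 3 * a)"
      using r(5) by (simp add: algebra_simps)
    ultimately show ?thesis using r(2-4) unfolding \<theta>_def
      by (intro exI[of _ r] exI[of _ "(c + 3 * a) + (c + 5 * a) + t"] conjI)
  qed
qed

text \<open>Since \<open>1 - rate\<close> is at most \<open>exp (- rate)\<close>, the stated
  \<open>N\<close> pushes the contraction factor below the threshold; the loop invariant starts with
  \<open>k = 0\<close>.\<close>

lemma AGD_terminates:
  assumes y1: "y\<^sub>1 \<in> carrier_vec d"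
    and D: "\<And>y. y \<in> carrier_vec d \<Longrightarrow> g y\<^sub>1 - g y \<le> D" and "D > 0"
    and "\<epsilon> > 0" and "a \<ge> 0" and "c \<ge> 0"
    and N: "real N \<ge> sqrt (L / \<sigma>) * ln (10 * L * D / \<epsilon>\<^sup>2)"
  shows "\<exists>r t. AGD d a c g y\<^sub>1 \<epsilon> L \<sigma> r t \<and> r \<in> carrier_vec d
    \<and> eucl_norm (gradient d g r) \<le> \<epsilon> \<and> g r \<le> g y\<^sub>1
    \<and> t \<le> 7 * a + real N * (2 * c + 8 * a) + (c + 3 * a)"
proof -
  have "(1 - rate) ^ N \<le> exp (- rate) ^ N"
    using rate_less_1 exp_ge_add_one_self[of "- rate"] by (intro power_mono) auto
  also have "\<dots> = exp (- (rate * real N))" by (simp flip: exp_of_nat_mult add: mult.commute)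
  also have "\<dots> \<le> exp (- ln (10 * L * D / \<epsilon>\<^sup>2))"
  proof -
    have "rate * (sqrt (L / \<sigma>) * ln (10 * L * D / \<epsilon>\<^sup>2)) \<le> rate * real N"
      using N rate_pos by simp
    moreover have "rate * sqrt (L / \<sigma>) = 1"
      using \<sigma>_pos L_pos by (simp add: rate_def flip: real_sqrt_mult)
    ultimately show ?thesis by (simp flip: mult.assoc)
  qed
  also have "\<dots> = \<epsilon>\<^sup>2 / (10 * L * D)"
    using L_pos \<open>D > 0\<close> \<open>\<epsilon> > 0\<close> by (simp add: exp_minus)
  finally have "10 * L * (1 - rate) ^ (0 + N) * D \<le> \<epsilon>\<^sup>2"
    using L_pos \<open>D > 0\<close> by (simp add: field_simps)
  from AGD_loop_terminates[OF y1 D this \<open>\<epsilon> > 0\<close> \<open>a \<ge> 0\<close> \<open>c \<ge> 0\<close> y1 y1]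
  show ?thesis unfolding AGD_def Let_def momentum_eq by fastforce
qed

end

section \<open>Almost convex accelerated gradient descent\<close>

lemma gradient_prox_fun:
  assumes "smooth_fun d L f" "x \<in> carrier_vec d" "w \<in> carrier_vec d" "\<gamma> > 0"
  shows "gradient d (prox_fun f \<gamma> w) x = gradient d f x + (2 * \<gamma>) \<cdot>\<^sub>v (x - w)"
  using gradient_eqI[OF has_gradient_prox_fun[OF has_gradient_gradient]] assms by blast

text \<open>The proximal term adds exactly \<gamma> to the coefficient of the squared distance: L/2
  becomes (L + 2\<gamma>)/2, and -\<alpha>/2 becomes at least \<gamma>/2 because \<alpha> \<le>
  \<gamma>.\<close>

lemma strongly_convex_smooth_prox_fun:
  assumes f: "smooth_fun d L f" and convex: "almost_convex d \<alpha> f" and "\<alpha> \<le> \<gamma>"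
    and "0 < \<gamma>" "0 < L" and w: "w \<in> carrier_vec d"
  shows "strongly_convex_smooth d (prox_fun f \<gamma> w) (L + 2 * \<gamma>) \<gamma>"
proof
  show "0 < \<gamma>" "\<gamma> < L + 2 * \<gamma>" using assms by auto
next
  fix x :: "real vec" assume x: "x \<in> carrier_vec d"
  then show "gradient d (prox_fun f \<gamma> w) x \<in> carrier_vec d"
    using gradient_prox_fun[OF f x w \<open>0 < \<gamma>\<close>] gradient_carrier[OF f x] w by simp
  fix y :: "real vec" assume y: "y \<in> carrier_vec d"
  have e: "prox_fun f \<gamma> w y + gradient d f x \<bullet> (y - x) - f y
    = prox_fun f \<gamma> w x + gradient d (prox_fun f \<gamma> w) x \<bullet> (y - x) - f x
      + \<gamma> * (eucl_norm (y - x))\<^sup>2"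
    using prox_quadratic_expansion[OF x y w gradient_carrier[OF f x], of \<gamma>]
    by (simp add: prox_fun_def gradient_prox_fun[OF f x w \<open>0 < \<gamma>\<close>])
  have "(L + 2 * \<gamma>) / 2 * (eucl_norm (y - x))\<^sup>2
      = L / 2 * (eucl_norm (y - x))\<^sup>2 + \<gamma> * (eucl_norm (y - x))\<^sup>2"
    by (simp add: field_simps)
  with e smooth_fun_quadratic_upper_bound[OF f x y]
  show "prox_fun f \<gamma> w y \<le> prox_fun f \<gamma> w x + gradient d (prox_fun f \<gamma> w) x \<bullet> (y - x)
      + (L + 2 * \<gamma>) / 2 * (eucl_norm (y - x))\<^sup>2"
    by linarith
  have "\<alpha> * (eucl_norm (y - x))\<^sup>2 \<le> \<gamma> * (eucl_norm (y - x))\<^sup>2"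
    using \<open>\<alpha> \<le> \<gamma>\<close> by (intro mult_right_mono) auto
  moreover have "f y \<ge> f x + gradient d f x \<bullet> (y - x) - \<alpha> / 2 * (eucl_norm (y - x))\<^sup>2"
    using convex x y by (simp add: almost_convex_def)
  ultimately show "prox_fun f \<gamma> w x + gradient d (prox_fun f \<gamma> w) x \<bullet> (y - x)
      + \<gamma> / 2 * (eucl_norm (y - x))\<^sup>2 \<le> prox_fun f \<gamma> w y"
    using e by simp
qed

section \<open>Progress of the outer loop\<close>

text \<open>The gradients of \<open>f\<close> and of the proximal function at \<open>z'\<close>
  differ by \<open>2 * \<gamma>\<close> times the displacement, which must therefore account for at
  least 11/12 of \<epsilon>.\<close>

lemma prox_step_progress:
  assumes f: "smooth_fun d L f" and z: "z \<in> carrier_vec d" and z': "z' \<in> carrier_vec d"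
    and "\<gamma> > 0" and small: "eucl_norm (gradient d (prox_fun f \<gamma> z) z') \<le> \<epsilon> / 12"
    and large: "\<epsilon> < eucl_norm (gradient d f z')"
  shows "11 / 24 * \<epsilon> \<le> \<gamma> * eucl_norm (z' - z)"
proof -
  let ?G = "gradient d (prox_fun f \<gamma> z) z'"
  have F: "gradient d f z' \<in> carrier_vec d" using gradient_carrier[OF f z'] .
  have G: "?G = gradient d f z' + (2 * \<gamma>) \<cdot>\<^sub>v (z' - z)"
    using gradient_prox_fun[OF f z' z \<open>\<gamma> > 0\<close>] .
  have "gradient d f z' = ?G + (- (2 * \<gamma>)) \<cdot>\<^sub>v (z' - z)"
    unfolding G using F z z' by (intro eq_vecI) auto
  then have "eucl_norm (gradient d f z') \<le> eucl_norm ?G + eucl_norm ((- (2 * \<gamma>)) \<cdot>\<^sub>v (z' - z))"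
    using F z z' eucl_norm_triangle[of ?G d "(- (2 * \<gamma>)) \<cdot>\<^sub>v (z' - z)"] by (simp add: G)
  then show ?thesis using small large \<open>\<gamma> > 0\<close> by (simp add: eucl_norm_smult)
qed

text \<open>A step of length \<open>p \<ge> 11 \<epsilon> / (24 \<gamma>)\<close> decreases \<open>f\<close> by enough to make up for the deficit
  \<open>\<epsilon>\<^sup>2 / (40 \<gamma>)\<close> in \<open>\<gamma> q\<^sup>2 \<ge> \<epsilon> q / sqrt 10 - \<epsilon>\<^sup>2 / (40 \<gamma>)\<close>, which is all that is known about a
  short final step.\<close>

lemma combine_progress:
  fixes p q :: real
  assumes "\<epsilon> > 0" "\<gamma> > 0" and q: "q \<ge> 0" and long: "11 / 24 * \<epsilon> \<le> \<gamma> * p"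
    and A: "\<gamma> * p\<^sup>2 \<le> A" and B: "min (\<gamma> * q\<^sup>2) (\<epsilon> / sqrt 10 * q) \<le> B"
  shows "\<epsilon> / sqrt 10 * (p + q) \<le> A + B"
proof -
  define s where "s = \<epsilon> / sqrt 10"
  have ss: "s\<^sup>2 = \<epsilon>\<^sup>2 / 10" by (simp add: s_def power_divide)
  have "s\<^sup>2 \<le> (\<epsilon> / 3)\<^sup>2" unfolding ss by (simp add: power_divide)
  then have s3: "s \<le> \<epsilon> / 3" by (rule power2_le_imp_le) (use \<open>\<epsilon> > 0\<close> in simp)
  \<comment> \<open>Here 1/8 = 11/24 - 1/3, a lower bound for the second factor in units of
    \<epsilon>.\<close>
  have "(11 / 24 * \<epsilon>) * (\<epsilon> / 8) \<le> (\<gamma> * p) * (\<gamma> * p - s)"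
    by (rule mult_mono) (use long s3 \<open>\<epsilon> > 0\<close> in linarith)+
  moreover have "(11 / 24 * \<epsilon>) * (\<epsilon> / 8) = 11 / 192 * \<epsilon>\<^sup>2" by (simp add: power2_eq_square)
  ultimately have a: "\<epsilon>\<^sup>2 / 40 \<le> (\<gamma> * p) * (\<gamma> * p - s)"
    using zero_le_power2[of \<epsilon>] by linarith
  have "s * (p + q) \<le> A + B" if "\<epsilon> / sqrt 10 * q \<le> B"
  proof -
    have "0 < \<gamma> * p" using long \<open>\<epsilon> > 0\<close> by linarith
    then have "p > 0" using \<open>\<gamma> > 0\<close> by (rule zero_less_mult_pos)
    moreover have "s \<le> \<gamma> * p" using long s3 \<open>\<epsilon> > 0\<close> by linarith
    ultimately have "s * p \<le> \<gamma> * p * p" by (intro mult_right_mono) auto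
    then show ?thesis using that A by (simp add: s_def[symmetric] power2_eq_square algebra_simps)
  qed
  moreover have "s * (p + q) \<le> A + B" if "\<gamma> * q\<^sup>2 \<le> B"
  proof -
    \<comment> \<open>Completing the square; the deficit is
      \<open>s\<^sup>2 / 4 = \<epsilon>\<^sup>2 / 40\<close>, covered by the surplus
      \<open>a\<close> of the long step.\<close>
    have "0 \<le> (\<gamma> * q - s / 2)\<^sup>2" by simp
    then have "s * (\<gamma> * q) - \<epsilon>\<^sup>2 / 40 \<le> (\<gamma> * q)\<^sup>2"
      using ss by (simp add: power2_diff power_divide algebra_simps)
    with a have "\<gamma> * (s * (p + q)) \<le> \<gamma> * (\<gamma> * p\<^sup>2 + \<gamma> * q\<^sup>2)"
      by (simp add: power2_eq_square algebra_simps)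
    then have "s * (p + q) \<le> \<gamma> * p\<^sup>2 + \<gamma> * q\<^sup>2" using \<open>\<gamma> > 0\<close> by simp
    then show ?thesis using that A by linarith
  qed
  ultimately show ?thesis using B unfolding s_def min_le_iff_disj by blast
qed

text \<open>The assumption \<open>step\<close> collects what one inner run guarantees on the
  sublevel set of \<open>M\<close>, which the iterates never leave. \<open>B\<close> bounds the time
  of one outer iteration. An iteration after which the loop goes on is paid for by its decrease of
  \<open>f\<close>; the summand 2 pays for a possibly short last iteration and the final
  test.\<close>

lemma ACAGD_terminates:
  fixes f :: "real vec \<Rightarrow> real" and B :: real
  assumes "\<epsilon> > 0" "\<gamma> > 0" "0 \<le> a" "0 \<le> c" and m: "\<And>z. z \<in> carrier_vec d \<Longrightarrow> m \<le> f z"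
    and B: "c + 3 * a \<le> B"
    and step: "\<And>z. z \<in> carrier_vec d \<Longrightarrow> f z \<le> M \<Longrightarrow> \<exists>z' s.
      AGD d a (c + 3 * a) (prox_fun f \<gamma> z) z (\<epsilon> * sqrt (\<gamma> / (50 * (L + 2 * \<gamma>)))) (L + 2 * \<gamma>) \<gamma> z' s
      \<and> z' \<in> carrier_vec d \<and> f z' + \<gamma> * (eucl_norm (z' - z))\<^sup>2 \<le> f z
      \<and> (\<epsilon> < eucl_norm (gradient d f z') \<longrightarrow> 11 / 24 * \<epsilon> \<le> \<gamma> * eucl_norm (z' - z))
      \<and> (c + 3 * a) + 6 * a + s \<le> B"
    and z: "z \<in> carrier_vec d" "f z \<le> M"
  shows "\<exists>r t. ACAGD d a c f z \<epsilon> \<gamma> L r t \<and> r \<in> carrier_vec d \<and> eucl_norm (gradient d f r) \<le> \<epsilon>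
    \<and> min (\<gamma> * (eucl_norm (r - z))\<^sup>2) (\<epsilon> / sqrt 10 * eucl_norm (r - z)) \<le> f z - f r
    \<and> t \<le> B * (2 + 5 * (\<gamma> / \<epsilon>\<^sup>2 * (f z - f r)))"
proof -
  \<comment> \<open>Guaranteed decrease of a long step, as (11/24)^2 exceeds 1/5.\<close>
  define \<delta> where "\<delta> = \<epsilon>\<^sup>2 / (5 * \<gamma>)"
  have \<delta>: "\<delta> > 0" using assms by (simp add: \<delta>_def)
  have "B \<ge> 0" using B \<open>0 \<le> a\<close> \<open>0 \<le> c\<close> by linarith
  \<comment> \<open>Bounds the number of long steps still possible; for \<open>n = 0\<close> the
    value would lie below \<open>m\<close>.\<close>
  obtain n where "f z - m < real n * \<delta>" using ex_less_of_nat_mult[OF \<delta>] by blast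
  then show ?thesis using z
  proof (induction n arbitrary: z)
    case 0
    then show ?case using m[of z] by simp
  next
    case (Suc n)
    show ?case
    proof (cases "eucl_norm (gradient d f z) \<le> \<epsilon>")
      case True
      then have "ACAGD d a c f z \<epsilon> \<gamma> L z (c + 3 * a)" by (rule ACAGD_stop)
      moreover have "c + 3 * a \<le> B * (2 + 5 * (\<gamma> / \<epsilon>\<^sup>2 * (f z - f z)))" using B \<open>B \<ge> 0\<close> by simp
      moreover have "min (\<gamma> * (eucl_norm (z - z))\<^sup>2) (\<epsilon> / sqrt 10 * eucl_norm (z - z)) \<le> f z - f z"
        by (simp add: eucl_norm_diff_self)
      ultimately show ?thesis using True Suc.prems(2) by blast
    next
      case False
      obtain z' s where run: "AGD d a (c + 3 * a) (prox_fun f \<gamma> z) z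
          (\<epsilon> * sqrt (\<gamma> / (50 * (L + 2 * \<gamma>)))) (L + 2 * \<gamma>) \<gamma> z' s"
        and z': "z' \<in> carrier_vec d" and dec: "f z' + \<gamma> * (eucl_norm (z' - z))\<^sup>2 \<le> f z"
        and long: "\<epsilon> < eucl_norm (gradient d f z') \<Longrightarrow> 11 / 24 * \<epsilon> \<le> \<gamma> * eucl_norm (z' - z)"
        and s: "(c + 3 * a) + 6 * a + s \<le> B"
        using step[OF Suc.prems(2,3)] by blast
      note iterate = ACAGD_iterate[OF False refl run]
      have nonneg: "0 \<le> \<gamma> * (eucl_norm (z' - z))\<^sup>2" using \<open>\<gamma> > 0\<close> by simp
      show ?thesis
      proof (cases "eucl_norm (gradient d f z') \<le> \<epsilon>")
        case True
        have "ACAGD d a c f z \<epsilon> \<gamma> L z' ((c + 3 * a) + 6 * a + s + (c + 3 * a))"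
          by (rule iterate[OF ACAGD_stop[OF True]])
        moreover have "(c + 3 * a) + 6 * a + s + (c + 3 * a)
            \<le> B * (2 + 5 * (\<gamma> / \<epsilon>\<^sup>2 * (f z - f z')))"
        proof -
          have "0 \<le> f z - f z'" using dec nonneg by linarith
          then have "0 \<le> B * (5 * (\<gamma> / \<epsilon>\<^sup>2 * (f z - f z')))"
            using \<open>B \<ge> 0\<close> \<open>\<gamma> > 0\<close> by simp
          then show ?thesis using s B by (simp add: distrib_left)
        qed
        \<comment> \<open>A single step, however short, attains the quadratic branch of the
          minimum.\<close>
        moreover have "min (\<gamma> * (eucl_norm (z' - z))\<^sup>2) (\<epsilon> / sqrt 10 * eucl_norm (z' - z))
            \<le> f z - f z'"
          using dec by (intro min.coboundedI1) simp
        ultimately show ?thesis using True z' by blast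
      next
        case False
        then have long: "11 / 24 * \<epsilon> \<le> \<gamma> * eucl_norm (z' - z)" using long by simp
        have "(11 / 24 * \<epsilon>)\<^sup>2 \<le> (\<gamma> * eucl_norm (z' - z))\<^sup>2"
          using long \<open>\<epsilon> > 0\<close> by (intro power_mono) auto
        moreover have "(11 / 24 * \<epsilon>)\<^sup>2 = 121 / 576 * \<epsilon>\<^sup>2" by (simp add: power2_eq_square)
        moreover have "(\<gamma> * eucl_norm (z' - z))\<^sup>2 = \<gamma> * (\<gamma> * (eucl_norm (z' - z))\<^sup>2)"
          by (simp add: power2_eq_square)
        ultimately have "\<epsilon>\<^sup>2 / 5 \<le> \<gamma> * (\<gamma> * (eucl_norm (z' - z))\<^sup>2)"
          using zero_le_power2[of \<epsilon>] by linarith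
        then have "\<delta> \<le> \<gamma> * (eucl_norm (z' - z))\<^sup>2"
          using \<open>\<gamma> > 0\<close> by (simp add: \<delta>_def field_simps)
        then have \<delta>_dec: "\<delta> \<le> f z - f z'" using dec by linarith
        have n: "f z' - m < real n * \<delta>" using Suc.prems(1) \<delta>_dec by (simp add: algebra_simps)
        have "f z' \<le> M" using \<delta>_dec \<delta> Suc.prems(3) by linarith
        then obtain r t where r: "ACAGD d a c f z' \<epsilon> \<gamma> L r t" "r \<in> carrier_vec d"
          "eucl_norm (gradient d f r) \<le> \<epsilon>"
          and min: "min (\<gamma> * (eucl_norm (r - z'))\<^sup>2) (\<epsilon> / sqrt 10 * eucl_norm (r - z'))
            \<le> f z' - f r"
          and t: "t \<le> B * (2 + 5 * (\<gamma> / \<epsilon>\<^sup>2 * (f z' - f r)))"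
          using Suc.IH[OF n z'] by blast
        have "ACAGD d a c f z \<epsilon> \<gamma> L r ((c + 3 * a) + 6 * a + s + t)"
          by (rule iterate[OF r(1)])
        moreover have "(c + 3 * a) + 6 * a + s + t \<le> B * (2 + 5 * (\<gamma> / \<epsilon>\<^sup>2 * (f z - f r)))"
        proof -
          have "5 * (\<gamma> / \<epsilon>\<^sup>2 * \<delta>) = 1" using \<open>\<epsilon> > 0\<close> \<open>\<gamma> > 0\<close> by (simp add: \<delta>_def)
          moreover have "5 * (\<gamma> / \<epsilon>\<^sup>2 * \<delta>) \<le> 5 * (\<gamma> / \<epsilon>\<^sup>2 * (f z - f z'))"
            using \<delta>_dec \<open>\<gamma> > 0\<close> by (intro mult_left_mono) auto
          ultimately have "1 \<le> 5 * (\<gamma> / \<epsilon>\<^sup>2 * (f z - f z'))" by linarith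
          from mult_left_mono[OF this \<open>B \<ge> 0\<close>]
          have "B * 1 \<le> B * (5 * (\<gamma> / \<epsilon>\<^sup>2 * (f z - f z')))" .
          with s t have "(c + 3 * a) + 6 * a + s + t \<le> B * (5 * (\<gamma> / \<epsilon>\<^sup>2 * (f z - f z')))
              + B * (2 + 5 * (\<gamma> / \<epsilon>\<^sup>2 * (f z' - f r)))" by linarith
          also have "\<dots> = B * (2 + 5 * (\<gamma> / \<epsilon>\<^sup>2 * (f z - f r)))"
            by (simp add: algebra_simps diff_divide_distrib)
          finally show ?thesis .
        qed
        moreover have "min (\<gamma> * (eucl_norm (r - z))\<^sup>2) (\<epsilon> / sqrt 10 * eucl_norm (r - z)) \<le> f z - f r"
        \<comment> \<open>After a long step the linear branch holds, and it adds up along the run by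
          the triangle inequality.\<close>
        proof (rule min.coboundedI2)
          have "\<epsilon> / sqrt 10 * eucl_norm (r - z)
              \<le> \<epsilon> / sqrt 10 * (eucl_norm (z' - z) + eucl_norm (r - z'))"
            using eucl_norm_minus_triangle[OF r(2) z' Suc.prems(2)] \<open>\<epsilon> > 0\<close>
            by (intro mult_left_mono) auto
          also have "\<dots> \<le> (f z - f z') + (f z' - f r)"
            using dec \<open>\<epsilon> > 0\<close> \<open>\<gamma> > 0\<close>
            by (intro combine_progress[OF _ _ eucl_norm_nonneg long _ min]) auto
          finally show "\<epsilon> / sqrt 10 * eucl_norm (r - z) \<le> f z - f r" by simp
        qed
        ultimately show ?thesis using r by blast
      qed
    qed
  qed
qed

section \<open>Constants and total running time\<close>

text \<open>As L + 2\<gamma> \<le> 3L and L/\<gamma> \<ge> 1, the argument of the logarithm is at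
  most 4500 X. A power of 2 + X absorbs the constant and costs a factor 14 outside the logarithm;
  the square root costs the other factor 2.\<close>

lemma AGD_iteration_bound:
  fixes L \<gamma> \<epsilon> \<Delta> :: real
  assumes "0 < \<gamma>" "\<gamma> \<le> L" "\<epsilon> > 0" "\<Delta> > 0"
  defines "X \<equiv> L ^ 3 * \<Delta> / (\<gamma>\<^sup>2 * \<epsilon>\<^sup>2)"
  shows "sqrt ((L + 2 * \<gamma>) / \<gamma>)
      * ln (10 * (L + 2 * \<gamma>) * \<Delta> / (\<epsilon> * sqrt (\<gamma> / (50 * (L + 2 * \<gamma>))))\<^sup>2)
    \<le> 28 * (sqrt (L / \<gamma>) * ln (2 + X))"
proof -
  have L: "L > 0" using assms by linarith
  have X: "X > 0" using assms L by (simp add: X_def)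
  have arg: "10 * (L + 2 * \<gamma>) * \<Delta> / (\<epsilon> * sqrt (\<gamma> / (50 * (L + 2 * \<gamma>))))\<^sup>2
      = 500 * (L + 2 * \<gamma>)\<^sup>2 * \<Delta> / (\<epsilon>\<^sup>2 * \<gamma>)" (is "?arg = _")
    using assms L by (simp add: power_mult_distrib power2_eq_square field_simps)
  have "(L + 2 * \<gamma>)\<^sup>2 \<le> (3 * L)\<^sup>2" using assms L by (intro power_mono) auto
  then have "500 * (L + 2 * \<gamma>)\<^sup>2 * \<Delta> / (\<epsilon>\<^sup>2 * \<gamma>) \<le> 500 * (3 * L)\<^sup>2 * \<Delta> / (\<epsilon>\<^sup>2 * \<gamma>)"
    using assms by (intro divide_right_mono mult_right_mono mult_left_mono) auto
  also have "\<dots> = 4500 * (L\<^sup>2 * \<Delta> / (\<epsilon>\<^sup>2 * \<gamma>)) * 1" by (simp add: power_mult_distrib)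
  also have "\<dots> \<le> 4500 * (L\<^sup>2 * \<Delta> / (\<epsilon>\<^sup>2 * \<gamma>)) * (L / \<gamma>)"
    using assms by (intro mult_left_mono) auto
  also have "\<dots> = 4500 * X"
    by (simp add: X_def power2_eq_square power3_eq_cube mult_ac)
  finally have "?arg \<le> 4500 * X" unfolding arg .
  \<comment> \<open>Uses 4500 \<le> 8192; the base 2 is then raised to 2 + X.\<close>
  also have "\<dots> \<le> 2 ^ 13 * (2 + X)" using X by simp
  also have "\<dots> \<le> (2 + X) ^ 13 * (2 + X)" using X by (intro mult_right_mono power_mono) auto
  also have "\<dots> = (2 + X) ^ 14" by (simp flip: power_Suc2)
  finally have le: "?arg \<le> (2 + X) ^ 14" .
  have "?arg > 0" unfolding arg using assms L by simp
  then have "ln ?arg \<le> ln ((2 + X) ^ 14)" using le by (subst ln_le_cancel_iff) auto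
  also have "\<dots> = 14 * ln (2 + X)" using X by (simp add: ln_realpow)
  finally have ln: "ln ?arg \<le> 14 * ln (2 + X)" .
  have "(L + 2 * \<gamma>) / \<gamma> \<le> 2\<^sup>2 * (L / \<gamma>)" using assms by (simp add: field_simps)
  then have "sqrt ((L + 2 * \<gamma>) / \<gamma>) \<le> 2 * sqrt (L / \<gamma>)"
    by (metis real_sqrt_abs real_sqrt_le_mono real_sqrt_mult abs_numeral)
  \<comment> \<open>\<open>ln ?arg\<close> may be negative, so it is replaced by its nonnegative
    bound before the square root is enlarged.\<close>
  with ln have "sqrt ((L + 2 * \<gamma>) / \<gamma>) * ln ?arg \<le> (2 * sqrt (L / \<gamma>)) * (14 * ln (2 + X))"
    using X assms L
    by (intro order_trans[OF mult_left_mono[OF ln] mult_right_mono]) auto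
  then show ?thesis by simp
qed

text \<open>\<open>K\<close> is the constant hidden in the cost model, so \<open>C\<close> may
  depend on it but on no problem data. \<open>bdd_below\<close> expresses that the infimum is
  finite.\<close>

theorem lemma3p1:
  fixes K :: real
  assumes "K > 0"
  shows "\<exists>C>0. \<forall>(d::nat) (f :: real vec \<Rightarrow> real) (\<sigma>\<^sub>1::real) (L\<^sub>1::real) (\<gamma>::real) (\<epsilon>::real)
            (\<Delta>\<^sub>f::real) (z\<^sub>1 :: real vec) (T_grad::real) (c_grad::real) (c_arith::real).
     almost_convex d (max \<sigma>\<^sub>1 0) f \<longrightarrow>
     smooth_fun d L\<^sub>1 f \<longrightarrow>
     z\<^sub>1 \<in> carrier_vec d \<longrightarrow>
     \<Delta>\<^sub>f > 0 \<longrightarrow>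
     bdd_below (f ` carrier_vec d) \<longrightarrow>
     f z\<^sub>1 - (INF x\<in>carrier_vec d. f x) \<le> \<Delta>\<^sub>f \<longrightarrow>
     \<epsilon> > 0 \<longrightarrow>
     \<gamma> \<ge> \<sigma>\<^sub>1 \<longrightarrow> 0 < \<gamma> \<longrightarrow> \<gamma> \<le> L\<^sub>1 \<longrightarrow>
     T_grad > 0 \<longrightarrow>
     0 \<le> c_grad \<longrightarrow> c_grad \<le> K * T_grad \<longrightarrow>
     0 \<le> c_arith \<longrightarrow> c_arith \<le> K * T_grad \<longrightarrow>
     (\<exists>z t. ACAGD d c_arith c_grad f z\<^sub>1 \<epsilon> \<gamma> L\<^sub>1 z t \<and>
        z \<in> carrier_vec d \<and>
        eucl_norm (gradient d f z) \<le> \<epsilon> \<and>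
        f z\<^sub>1 - f z \<ge> min (\<gamma> * (eucl_norm (z - z\<^sub>1))\<^sup>2)
                          (\<epsilon> / sqrt 10 * eucl_norm (z - z\<^sub>1)) \<and>
        t \<le> C * (T_grad
               * (sqrt (L\<^sub>1 / \<gamma>) + sqrt (\<gamma> * L\<^sub>1) / \<epsilon>\<^sup>2 * (f z\<^sub>1 - f z))
               * ln (2 + L\<^sub>1 ^ 3 * \<Delta>\<^sub>f / (\<gamma>\<^sup>2 * \<epsilon>\<^sup>2))))"
\<comment> \<open>2640 = 5 * 528, with 528 from the cost \<open>B\<close> of one outer
  iteration.\<close>
proof (intro exI[of _ "2640 * K"] conjI allI impI)
  show "2640 * K > 0" using assms by simp
next
  fix d :: nat and f :: "real vec \<Rightarrow> real" and \<sigma>\<^sub>1 L \<gamma> \<epsilon> \<Delta> :: real and z\<^sub>1 :: "real vec"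
    and T c a :: real
  assume convex: "almost_convex d (max \<sigma>\<^sub>1 0) f" and smooth: "smooth_fun d L f"
    and z1: "z\<^sub>1 \<in> carrier_vec d" and "\<Delta> > 0" and bdd: "bdd_below (f ` carrier_vec d)"
    and gap: "f z\<^sub>1 - (INF x\<in>carrier_vec d. f x) \<le> \<Delta>" and "\<epsilon> > 0"
    and "\<gamma> \<ge> \<sigma>\<^sub>1" "0 < \<gamma>" "\<gamma> \<le> L" and "T > 0"
    and c: "0 \<le> c" "c \<le> K * T" and a: "0 \<le> a" "a \<le> K * T"
  have "L > 0" using \<open>0 < \<gamma>\<close> \<open>\<gamma> \<le> L\<close> by linarith
  define m where "m = (INF x\<in>carrier_vec d. f x)"
  have m: "m \<le> f z" if "z \<in> carrier_vec d" for z
    unfolding m_def using bdd that by (rule cINF_lower)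
  define X where "X = L ^ 3 * \<Delta> / (\<gamma>\<^sup>2 * \<epsilon>\<^sup>2)"
  define W where "W = sqrt (L / \<gamma>) * ln (2 + X)"
  have "X > 0" using \<open>L > 0\<close> \<open>\<Delta> > 0\<close> \<open>\<epsilon> > 0\<close> \<open>0 < \<gamma>\<close> by (simp add: X_def)
  then have "ln 2 \<le> ln (2 + X)" by simp
  \<comment> \<open>Yields ln 2 \<ge> 1/2, hence a lower bound on \<open>W\<close> by which additive
    constants are absorbed.\<close>
  moreover have "ln (1 / 2 :: real) \<le> 1 / 2 - 1" by (rule ln_le_minus_one) simp
  ultimately have ln: "1 / 2 \<le> ln (2 + X)" by (simp add: ln_div)
  have "1 \<le> sqrt (L / \<gamma>)" using \<open>0 < \<gamma>\<close> \<open>\<gamma> \<le> L\<close> by simp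
  then have "1 * (1 / 2) \<le> W" unfolding W_def using ln by (intro mult_mono) auto
  then have W: "1 \<le> 2 * W" by simp
  define \<epsilon>' where "\<epsilon>' = \<epsilon> * sqrt (\<gamma> / (50 * (L + 2 * \<gamma>)))"
  have "\<epsilon>' > 0" using \<open>\<epsilon> > 0\<close> \<open>0 < \<gamma>\<close> \<open>L > 0\<close> by (simp add: \<epsilon>'_def)
  have "\<epsilon>' \<le> \<epsilon> / 12"
  proof -
    \<comment> \<open>As \<gamma> \<le> L, the left side is at most 1/150, below 1/144.\<close>
    have "\<gamma> / (50 * (L + 2 * \<gamma>)) \<le> (1 / 12)\<^sup>2"
      using \<open>0 < \<gamma>\<close> \<open>\<gamma> \<le> L\<close> by (simp add: power2_eq_square field_simps)
    then have "sqrt (\<gamma> / (50 * (L + 2 * \<gamma>))) \<le> 1 / 12" by (intro real_le_lsqrt) auto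
    then have "\<epsilon> * sqrt (\<gamma> / (50 * (L + 2 * \<gamma>))) \<le> \<epsilon> * (1 / 12)"
      using \<open>\<epsilon> > 0\<close> by (intro mult_left_mono) auto
    then show ?thesis by (simp add: \<epsilon>'_def)
  qed
  define Q where "Q = sqrt ((L + 2 * \<gamma>) / \<gamma>) * ln (10 * (L + 2 * \<gamma>) * \<Delta> / \<epsilon>'\<^sup>2)"
  define N where "N = nat \<lceil>Q\<rceil>"
  have "Q \<le> real N" by (simp add: N_def real_nat_ceiling_ge)
  have "Q \<le> 28 * W"
    unfolding Q_def W_def X_def \<epsilon>'_def
    using AGD_iteration_bound \<open>0 < \<gamma>\<close> \<open>\<gamma> \<le> L\<close> \<open>\<epsilon> > 0\<close> \<open>\<Delta> > 0\<close> .
  \<comment> \<open>The maximum covers a negative \<open>Q\<close>; the rounding unit is then at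
    most \<open>2 * W\<close>.\<close>
  moreover have "real N \<le> max 0 Q + 1" unfolding N_def by linarith
  ultimately have N: "real N \<le> 30 * W" using W by linarith
  \<comment> \<open>528 = 30 * 16 + 2 * 24: at most \<open>30 * W\<close> inner iterations of at
    most 16 units \<open>K * T\<close>, and 24 units of overhead charged against
    \<open>2 * W\<close>.\<close>
  define B where "B = 528 * (K * T) * W"
  have KT: "K * T > 0" using \<open>K > 0\<close> \<open>T > 0\<close> by simp
  have cost: "(c + 3 * a) + 6 * a + (7 * a + real N * (2 * (c + 3 * a) + 8 * a) + ((c + 3 * a) + 3 * a))
      \<le> B"
  proof -
    have "real N * (2 * (c + 3 * a) + 8 * a) \<le> (30 * W) * (16 * (K * T))"
      using N c a W by (intro mult_mono) auto
    moreover have "2 * c + 22 * a \<le> 24 * (K * T) * 1" using c a by simp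
    moreover have "24 * (K * T) * 1 \<le> 24 * (K * T) * (2 * W)"
      using W KT by (intro mult_left_mono) auto
    ultimately show ?thesis unfolding B_def by (simp add: algebra_simps)
  qed
  have "0 \<le> real N * (2 * (c + 3 * a) + 8 * a)" using c a by simp
  with cost c a have B: "c + 3 * a \<le> B" by linarith
  have step: "\<exists>z' s. AGD d a (c + 3 * a) (prox_fun f \<gamma> z) z \<epsilon>' (L + 2 * \<gamma>) \<gamma> z' s
      \<and> z' \<in> carrier_vec d \<and> f z' + \<gamma> * (eucl_norm (z' - z))\<^sup>2 \<le> f z
      \<and> (\<epsilon> < eucl_norm (gradient d f z') \<longrightarrow> 11 / 24 * \<epsilon> \<le> \<gamma> * eucl_norm (z' - z))
      \<and> (c + 3 * a) + 6 * a + s \<le> B"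
    if z: "z \<in> carrier_vec d" and "f z \<le> f z\<^sub>1" for z
  proof -
    let ?g = "prox_fun f \<gamma> z"
    interpret strongly_convex_smooth d ?g "L + 2 * \<gamma>" \<gamma>
      using strongly_convex_smooth_prox_fun[OF smooth convex] \<open>\<gamma> \<ge> \<sigma>\<^sub>1\<close> \<open>0 < \<gamma>\<close> \<open>L > 0\<close> z by simp
    have gz: "?g z = f z" by (simp add: prox_fun_def eucl_norm_diff_self)
    \<comment> \<open>The sublevel condition makes the same \<Delta> serve for every inner
      run.\<close>
    have D: "?g z - ?g y \<le> \<Delta>" if "y \<in> carrier_vec d" for y
    proof -
      have "f y \<le> ?g y" using \<open>0 < \<gamma>\<close> by (simp add: prox_fun_def)
      then show ?thesis using m[OF that] gap \<open>f z \<le> f z\<^sub>1\<close> unfolding gz m_def by linarith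
    qed
    have "c + 3 * a \<ge> 0" using c a by simp
    from AGD_terminates[OF z D \<open>\<Delta> > 0\<close> \<open>\<epsilon>' > 0\<close> a(1) this \<open>Q \<le> real N\<close>[unfolded Q_def]]
    obtain z' s where run: "AGD d a (c + 3 * a) ?g z \<epsilon>' (L + 2 * \<gamma>) \<gamma> z' s"
      and z': "z' \<in> carrier_vec d" and grad: "eucl_norm (gradient d ?g z') \<le> \<epsilon>'"
      and dec: "?g z' \<le> ?g z"
      and s: "s \<le> 7 * a + real N * (2 * (c + 3 * a) + 8 * a) + ((c + 3 * a) + 3 * a)"
      by blast
    have "11 / 24 * \<epsilon> \<le> \<gamma> * eucl_norm (z' - z)" if "\<epsilon> < eucl_norm (gradient d f z')"
      using prox_step_progress[OF smooth z z' \<open>0 < \<gamma>\<close> _ that] grad \<open>\<epsilon>' \<le> \<epsilon> / 12\<close> by linarith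
    moreover have "f z' + \<gamma> * (eucl_norm (z' - z))\<^sup>2 \<le> f z" using dec unfolding gz by (simp add: prox_fun_def)
    moreover have "(c + 3 * a) + 6 * a + s \<le> B" using s cost by linarith
    ultimately show ?thesis using run z' by blast
  qed
  obtain r t where r: "ACAGD d a c f z\<^sub>1 \<epsilon> \<gamma> L r t" "r \<in> carrier_vec d"
    "eucl_norm (gradient d f r) \<le> \<epsilon>"
    "min (\<gamma> * (eucl_norm (r - z\<^sub>1))\<^sup>2) (\<epsilon> / sqrt 10 * eucl_norm (r - z\<^sub>1)) \<le> f z\<^sub>1 - f r"
    and t: "t \<le> B * (2 + 5 * (\<gamma> / \<epsilon>\<^sup>2 * (f z\<^sub>1 - f r)))"
    using ACAGD_terminates[OF \<open>\<epsilon> > 0\<close> \<open>0 < \<gamma>\<close> a(1) c(1) m B step[unfolded \<epsilon>'_def] z1 order_refl]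
    by blast
  have "t \<le> 2640 * K * (T * (sqrt (L / \<gamma>) + sqrt (\<gamma> * L) / \<epsilon>\<^sup>2 * (f z\<^sub>1 - f r)) * ln (2 + X))"
  proof -
    have "B \<ge> 0" using B c a by linarith
    then have "B * (2 + 5 * (\<gamma> / \<epsilon>\<^sup>2 * (f z\<^sub>1 - f r))) \<le> B * (5 * (1 + \<gamma> / \<epsilon>\<^sup>2 * (f z\<^sub>1 - f r)))"
      by (intro mult_left_mono) auto
    also have "\<dots> = 2640 * K * (T * (sqrt (L / \<gamma>) + sqrt (L / \<gamma>) * \<gamma> / \<epsilon>\<^sup>2 * (f z\<^sub>1 - f r)) * ln (2 + X))"
      by (simp add: B_def W_def algebra_simps)
    \<comment> \<open>The factor sqrt (L / \<gamma>) in \<open>W\<close> turns the outer count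
      \<gamma> / \<epsilon>^2 into the claimed sqrt (\<gamma> L) / \<epsilon>^2.\<close>
    also have "sqrt (L / \<gamma>) * \<gamma> = sqrt (\<gamma> * L)"
    proof -
      have "\<gamma> * L = L / \<gamma> * \<gamma>\<^sup>2" using \<open>0 < \<gamma>\<close> by (simp add: power2_eq_square)
      then have "sqrt (\<gamma> * L) = sqrt (L / \<gamma>) * sqrt (\<gamma>\<^sup>2)" by (simp only: real_sqrt_mult)
      then show ?thesis using \<open>0 < \<gamma>\<close> by simp
    qed
    finally show ?thesis using t by linarith
  qed
  with r show "\<exists>z t. ACAGD d a c f z\<^sub>1 \<epsilon> \<gamma> L z t \<and> z \<in> carrier_vec d
      \<and> eucl_norm (gradient d f z) \<le> \<epsilon>
      \<and> min (\<gamma> * (eucl_norm (z - z\<^sub>1))\<^sup>2) (\<epsilon> / sqrt 10 * eucl_norm (z - z\<^sub>1)) \<le> f z\<^sub>1 - f z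
      \<and> t \<le> 2640 * K * (T * (sqrt (L / \<gamma>) + sqrt (\<gamma> * L) / \<epsilon>\<^sup>2 * (f z\<^sub>1 - f z))
          * ln (2 + L ^ 3 * \<Delta> / (\<gamma>\<^sup>2 * \<epsilon>\<^sup>2)))"
    unfolding X_def by blast
qed

end
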